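(* Let $p,q$ be positive integers with $p\le q$ and $n=p+q$. (i) If $p=2$ (and $n\ge 4$), then every tree in $\mathscr{T}_n^{2,n-2}$ is isomorphic to $T(n,3,i)$ for exactly one $i$ with $0\le i\le\lfloor (n-3)/2\rfloor$, and $$\operatorname{per} L(D(2,n-2))=\operatorname{per} L(T(n,3,0))<\operatorname{per} L(T(n,3,1))<\cdots<\operatorname{per} L(T(n,3,i))<\cdots<\operatorname{per} L\big(T(n,3,\lfloor \tfrac{n-3}{2}\rfloor)\big).$$ (ii) If $p>2$, then: (a) for every $T\in\mathscr{T}_n^{p,q}$ not isomorphic to $D(p,q)$, $\operatorname{per} L(T)\ge (2p-3)(6q-5)+3$, with equality if and only if $T\cong D'(p-1,q-1)$; (b) if moreover $q>p$, then for every $T\in\mathscr{T}_n^{p,q}$ isomorphic to neither $D(p,q)$ nor $D'(p-1,q-1)$, $\operatorname{per} L(T)\ge (2q-3)(6p-5)+3$, with equality if and only if $T\cong D''(p-1,q-1)$.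
   Context: For a simple graph $G$, $L(G)=D(G)-A(G)$ is its Laplacian matrix ($D(G)$ the diagonal degree matrix, $A(G)$ the adjacency matrix), and $\operatorname{per} X=\sum_{\sigma\in S_n}\prod_{t=1}^n x_{t\sigma(t)}$ is the permanent of an $n\times n$ matrix $X$. A connected graph has a $(p,q)$-bipartition if its vertex set splits into two parts of sizes $p$ and $q$ with every edge joining the two parts; $\mathscr{T}_n^{p,q}$ is the set of all trees on $n=p+q$ vertices with a $(p,q)$-bipartition (with $p\le q$). $D(p,q)$ is the double star on $p+q$ vertices obtained from an edge $vw$ by attaching $p-1$ pendant vertices to $v$ and $q-1$ pendant vertices to $w$. $D'(p-1,q-1)$ (resp. $D''(p-1,q-1)$) is the tree on $p+q$ vertices obtained from $D(p-1,q-1)$ (with $p-2$ pendant vertices at $v$ and $q-2$ at $w$) by attaching a pendant path of length 2 at $w$ (resp. at $v$). $T(n,k,a)$ is the tree on $n$ vertices obtained from the path $P_k$ by attaching $a$ pendant vertices to one end-vertex and $n-k-a$ pendant vertices to the other end-vertex. *)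

theory Defs
  imports "HOL-Combinatorics.Permutations"
begin

definition simple_graph :: "nat \<Rightarrow> (nat \<Rightarrow> nat \<Rightarrow> bool) \<Rightarrow> bool" where
  "simple_graph n E \<longleftrightarrow> (\<forall>i j. E i j \<longrightarrow> i < n \<and> j < n \<and> i \<noteq> j \<and> E j i)"

definition connected_graph :: "nat \<Rightarrow> (nat \<Rightarrow> nat \<Rightarrow> bool) \<Rightarrow> bool" where
  "connected_graph n E \<longleftrightarrow> (\<forall>i<n. \<forall>j<n. E\<^sup>*\<^sup>* i j)"

definition acyclic_graph :: "nat \<Rightarrow> (nat \<Rightarrow> nat \<Rightarrow> bool) \<Rightarrow> bool" where
  "acyclic_graph n E \<longleftrightarrow>
     \<not> (\<exists>vs. 3 \<le> length vs \<and> distinct vs \<and> set vs \<subseteq> {..<n} \<and>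
            (\<forall>k. Suc k < length vs \<longrightarrow> E (vs ! k) (vs ! Suc k)) \<and> E (last vs) (hd vs))"

definition is_tree :: "nat \<Rightarrow> (nat \<Rightarrow> nat \<Rightarrow> bool) \<Rightarrow> bool" where
  "is_tree n E \<longleftrightarrow> 1 \<le> n \<and> simple_graph n E \<and> connected_graph n E \<and> acyclic_graph n E"

definition has_bipartition :: "nat \<Rightarrow> (nat \<Rightarrow> nat \<Rightarrow> bool) \<Rightarrow> nat \<Rightarrow> nat \<Rightarrow> bool" where
  "has_bipartition n E p q \<longleftrightarrow>
     (\<exists>A. A \<subseteq> {..<n} \<and> card A = p \<and> card ({..<n} - A) = q \<and>
          (\<forall>i j. E i j \<longrightarrow> (i \<in> A \<longleftrightarrow> j \<notin> A)))"

definition tree_pq :: "nat \<Rightarrow> nat \<Rightarrow> (nat \<Rightarrow> nat \<Rightarrow> bool) \<Rightarrow> bool" where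
  "tree_pq p q E \<longleftrightarrow> is_tree (p + q) E \<and> has_bipartition (p + q) E p q"

definition graph_iso :: "nat \<Rightarrow> (nat \<Rightarrow> nat \<Rightarrow> bool) \<Rightarrow> (nat \<Rightarrow> nat \<Rightarrow> bool) \<Rightarrow> bool" where
  "graph_iso n E F \<longleftrightarrow>
     (\<exists>f. bij_betw f {..<n} {..<n} \<and> (\<forall>i<n. \<forall>j<n. E i j \<longleftrightarrow> F (f i) (f j)))"

definition degree :: "nat \<Rightarrow> (nat \<Rightarrow> nat \<Rightarrow> bool) \<Rightarrow> nat \<Rightarrow> nat" where
  "degree n E i = card {j. j < n \<and> E i j}"

definition laplacian :: "nat \<Rightarrow> (nat \<Rightarrow> nat \<Rightarrow> bool) \<Rightarrow> nat \<Rightarrow> nat \<Rightarrow> int" where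
  "laplacian n E i j = (if i = j then int (degree n E i) else if E i j then -1 else 0)"

definition permanent :: "nat \<Rightarrow> (nat \<Rightarrow> nat \<Rightarrow> int) \<Rightarrow> int" where
  "permanent n X = (\<Sum>\<sigma>\<in>{\<sigma>. \<sigma> permutes {..<n}}. \<Prod>t<n. X t (\<sigma> t))"

definition per_lap :: "nat \<Rightarrow> (nat \<Rightarrow> nat \<Rightarrow> bool) \<Rightarrow> int" where
  "per_lap n E = permanent n (laplacian n E)"

definition sym_of :: "(nat \<Rightarrow> nat \<Rightarrow> bool) \<Rightarrow> nat \<Rightarrow> nat \<Rightarrow> bool" where
  "sym_of R i j \<longleftrightarrow> R i j \<or> R j i"

text \<open>Double star D(p,q) on p+q vertices: v = 0, w = 1, pendants 2..p at v, p+1..p+q-1 at w.\<close>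
definition dstar :: "nat \<Rightarrow> nat \<Rightarrow> nat \<Rightarrow> nat \<Rightarrow> bool" where
  "dstar p q = sym_of (\<lambda>i j. (i = 0 \<and> j = 1) \<or> (i = 0 \<and> 2 \<le> j \<and> j \<le> p)
                               \<or> (i = 1 \<and> p < j \<and> j < p + q))"

text \<open>D'(p-1,q-1) on n = p+q vertices: D(p-1,q-1) on vertices 0..n-3 (v = 0 with pendants
  2..p-1, w = 1 with pendants p..n-3) plus a pendant path 1 - (n-2) - (n-1) at w.\<close>
definition dstar' :: "nat \<Rightarrow> nat \<Rightarrow> nat \<Rightarrow> nat \<Rightarrow> bool" where
  "dstar' p q = sym_of (\<lambda>i j. (i = 0 \<and> j = 1) \<or> (i = 0 \<and> 2 \<le> j \<and> j + 1 \<le> p)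
       \<or> (i = 1 \<and> p \<le> j \<and> j + 3 \<le> p + q)
       \<or> (i = 1 \<and> j + 2 = p + q) \<or> (i + 2 = p + q \<and> j + 1 = p + q))"

text \<open>D''(p-1,q-1): same, but the pendant path 0 - (n-2) - (n-1) is attached at v.\<close>
definition dstar'' :: "nat \<Rightarrow> nat \<Rightarrow> nat \<Rightarrow> nat \<Rightarrow> bool" where
  "dstar'' p q = sym_of (\<lambda>i j. (i = 0 \<and> j = 1) \<or> (i = 0 \<and> 2 \<le> j \<and> j + 1 \<le> p)
       \<or> (i = 1 \<and> p \<le> j \<and> j + 3 \<le> p + q)
       \<or> (i = 0 \<and> j + 2 = p + q) \<or> (i + 2 = p + q \<and> j + 1 = p + q))"

definition Tnka :: "nat \<Rightarrow> nat \<Rightarrow> nat \<Rightarrow> nat \<Rightarrow> nat \<Rightarrow> bool" where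
  "Tnka n k a = sym_of (\<lambda>i j. (Suc i = j \<and> j < k) \<or> (i = 0 \<and> k \<le> j \<and> j < k + a)
       \<or> (Suc i = k \<and> k + a \<le> j \<and> j < n))"

end

theory Submission
  imports Defs
begin

text \<open>
  In a tree only products of fixed points and transposed edges contribute to the permanent of a
  principal submatrix of the Laplacian, so deleting a pendant vertex \<open>u\<close> attached to \<open>w\<close> gives
  \<open>per L(T) = per L(T - u) + 2 a\<close>, where \<open>a\<close> is the permanent of \<open>L (T - u)\<close> with the row and column of \<open>w\<close>
  removed. The same recurrence bounds \<open>a\<close> from below in terms of the two class sizes and the degree
  of \<open>w\<close>. Call a tree exceptional if there are vertices \<open>c\<close>, \<open>x\<close>, one in each class, that are joined
  to all vertices of the opposite class except at most one in total: these trees are \<open>D\<close>, \<open>D'\<close>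
  and \<open>D''\<close>. By induction, removing a leaf of the smaller class if there is one and of the larger
  class otherwise, every other tree has a permanent larger than both \<open>per L(D')\<close> and \<open>per L(D'')\<close>.
\<close>

section \<open>Permanents indexed by finite sets\<close>

text \<open>The order of removal is dictated by how fast \<open>hbound\<close> grows. Let the
  removed leaf hang at \<open>w\<close>, let \<open>p\<close> be the size of the class of
  \<open>w\<close>, and \<open>q\<close> the size of the other class after the removal. If
  \<open>q < p\<close>, then passing from \<open>q\<close> to \<open>q + 1\<close> raises
  \<open>hbound\<close> by \<open>12 * p - 18\<close>, so \<open>a\<close> has to be at least
  \<open>6 * p - 9\<close>; this can fail only if the smaller tree is a double star with hub
  \<open>w\<close>. If \<open>p \<le> q\<close>, the rise is \<open>12 * p - 10\<close>, so
  \<open>a\<close> has to be at least \<open>6 * p - 5\<close>; this holds as soon as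
  \<open>w\<close> misses a vertex of the other class. A vertex that misses none forces all other
  vertices of its own class to be leaves, so it suffices that the smaller class has no leaf. Both
  estimates are met with nothing to spare, so strictness has to come from the induction hypothesis.
  An exceptional smaller tree is therefore treated separately: attaching a leaf to D gives an
  exceptional tree again, so only the values at D' and D'' enter, and there \<open>w\<close> misses
  so many vertices that the gain exceeds what is needed. The two values differ by
  \<open>8 * (q - p)\<close>, and staying above the larger one settles (a) and (b) at once.\<close>

definition per :: "'a set \<Rightarrow> ('a \<Rightarrow> 'a \<Rightarrow> int) \<Rightarrow> int" where
  "per V X = (\<Sum>\<sigma> | \<sigma> permutes V. \<Prod>t\<in>V. X t (\<sigma> t))"

lemma per_cong:
  assumes "\<And>i j. i \<in> V \<Longrightarrow> j \<in> V \<Longrightarrow> X i j = Y i j"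
  shows "per V X = per V Y"
  unfolding per_def by (intro sum.cong prod.cong refl assms) (auto simp: permutes_in_image)

lemma per_empty [simp]: "per {} X = 1"
  by (simp add: per_def)

lemma per_split:
  assumes "finite V" "w \<in> V"
  shows "per V X = X w w * per (V - {w}) X + (\<Sum>\<sigma> | \<sigma> permutes V \<and> \<sigma> w \<noteq> w. \<Prod>t\<in>V. X t (\<sigma> t))"
proof -
  have eq: "{\<sigma>. \<sigma> permutes V \<and> \<sigma> w = w} = {\<sigma>. \<sigma> permutes (V - {w})}"
    using assms permutes_superset[of _ V "V - {w}"] permutes_subset[of _ "V - {w}" V]
    by (auto simp: permutes_not_in)
  have "per V X = (\<Sum>\<sigma> | \<sigma> permutes V \<and> \<sigma> w = w. \<Prod>t\<in>V. X t (\<sigma> t))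
      + (\<Sum>\<sigma> | \<sigma> permutes V \<and> \<sigma> w \<noteq> w. \<Prod>t\<in>V. X t (\<sigma> t))"
    unfolding per_def using finite_permutations[OF assms(1)]
    by (subst sum.union_disjoint[symmetric]) (auto intro!: sum.cong)
  also have "(\<Sum>\<sigma> | \<sigma> permutes V \<and> \<sigma> w = w. \<Prod>t\<in>V. X t (\<sigma> t))
      = (\<Sum>\<sigma> | \<sigma> permutes (V - {w}). X w w * (\<Prod>t\<in>V - {w}. X t (\<sigma> t)))"
    using assms by (intro sum.cong[OF eq]) (auto simp: prod.remove[OF assms] permutes_not_in intro!: prod.cong)
  finally show ?thesis by (simp add: per_def sum_distrib_left)
qed

text \<open>A permutation that moves \<open>w\<close> never reads the entry at
  \<open>(w, w)\<close>, so the permanent is affine in it. Needed because attaching a leaf raises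
  one degree.\<close>

lemma per_diag:
  assumes "finite V" "w \<in> V" "Y w w = X w w + k"
    and "\<And>i j. i \<in> V \<Longrightarrow> j \<in> V \<Longrightarrow> i \<noteq> w \<or> j \<noteq> w \<Longrightarrow> Y i j = X i j"
  shows "per V Y = per V X + k * per (V - {w}) X"
proof -
  have "per (V - {w}) Y = per (V - {w}) X" using assms(4) by (intro per_cong) auto
  moreover have "(\<Sum>\<sigma> | \<sigma> permutes V \<and> \<sigma> w \<noteq> w. \<Prod>t\<in>V. Y t (\<sigma> t))
      = (\<Sum>\<sigma> | \<sigma> permutes V \<and> \<sigma> w \<noteq> w. \<Prod>t\<in>V. X t (\<sigma> t))"
    by (intro sum.cong prod.cong refl assms(4)) (auto simp: permutes_in_image)
  ultimately show ?thesis
    using assms(3) by (simp add: per_split[OF assms(1,2)] algebra_simps)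
qed

lemma per_isolated:
  assumes "finite V" "u \<in> V" and "\<And>j. j \<in> V \<Longrightarrow> j \<noteq> u \<Longrightarrow> X u j = 0"
  shows "per V X = X u u * per (V - {u}) X"
proof -
  have "(\<Prod>t\<in>V. X t (\<sigma> t)) = 0" if "\<sigma> permutes V" "\<sigma> u \<noteq> u" for \<sigma>
    using that assms by (intro prod_zero) (auto simp: permutes_in_image intro!: bexI[of _ u])
  then show ?thesis by (simp add: per_split[OF assms(1,2)])
qed

text \<open>Row \<open>u\<close> vanishes off \<open>u\<close> and \<open>w\<close>, so a
  contributing permutation fixes \<open>u\<close> or sends it to \<open>w\<close>; in the second
  case column \<open>u\<close> forces \<open>w\<close> to be sent back to \<open>u\<close>.
  Composing with the transposition of \<open>u\<close> and \<open>w\<close> then leaves a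
  permutation of the remaining vertices.\<close>

lemma per_leaf:
  assumes "finite V" "u \<in> V" "w \<in> V" "u \<noteq> w"
    and "\<And>j. j \<in> V \<Longrightarrow> j \<noteq> u \<Longrightarrow> j \<noteq> w \<Longrightarrow> X u j = 0"
    and "\<And>j. j \<in> V \<Longrightarrow> j \<noteq> u \<Longrightarrow> j \<noteq> w \<Longrightarrow> X j u = 0"
  shows "per V X = X u u * per (V - {u}) X + X u w * X w u * per (V - {u} - {w}) X"
proof -
  let ?t = "Transposition.transpose u w"
  have zero: "(\<Prod>t\<in>V. X t (\<sigma> t)) = 0"
    if "\<sigma> permutes V" "\<sigma> u \<noteq> u" "\<not> (\<sigma> u = w \<and> \<sigma> w = u)" for \<sigma>
  proof (cases "\<sigma> u = w")
    case True
    have "inv \<sigma> u \<in> V" using that(1) assms(2) permutes_inv permutes_in_image by metis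
    moreover have "\<sigma> (inv \<sigma> u) = u" using that(1) permutes_inverses(1) by metis
    moreover have "inv \<sigma> u \<noteq> u" "inv \<sigma> u \<noteq> w" using that True calculation(2) by metis+
    ultimately show ?thesis using assms(6)[of "inv \<sigma> u"]
      by (intro prod_zero[OF assms(1)] bexI[of _ "inv \<sigma> u"]) auto
  next
    case False
    have "\<sigma> u \<in> V" using that(1) assms(2) permutes_in_image by metis
    then show ?thesis using assms(5)[of "\<sigma> u"] that(2) False assms(1,2)
      by (intro prod_zero bexI[of _ u]) auto
  qed
  have "(\<Sum>\<sigma> | \<sigma> permutes V \<and> \<sigma> u \<noteq> u. \<Prod>t\<in>V. X t (\<sigma> t))
      = (\<Sum>\<sigma> | \<sigma> permutes V \<and> \<sigma> u = w \<and> \<sigma> w = u. \<Prod>t\<in>V. X t (\<sigma> t))"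
    using finite_permutations[OF assms(1)] assms(4)
    by (intro sum.mono_neutral_right) (auto intro: zero)
  also have "\<dots> = (\<Sum>\<tau> | \<tau> permutes (V - {u} - {w}). X u w * X w u * (\<Prod>t\<in>V - {u} - {w}. X t (\<tau> t)))"
  proof (rule sum.reindex_bij_witness[of _ "\<lambda>\<tau>. ?t \<circ> \<tau>" "\<lambda>\<sigma>. ?t \<circ> \<sigma>"])
    fix \<sigma> assume "\<sigma> \<in> {\<sigma>. \<sigma> permutes V \<and> \<sigma> u = w \<and> \<sigma> w = u}"
    then have s: "\<sigma> permutes V" "\<sigma> u = w" "\<sigma> w = u" by auto
    show "?t \<circ> (?t \<circ> \<sigma>) = \<sigma>" by (simp add: fun_eq_iff)
    have "?t \<circ> \<sigma> permutes V" using s assms by (intro permutes_compose permutes_swap_id)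
    then have "?t \<circ> \<sigma> permutes (V - {u} - {w})"
      by (rule permutes_superset) (use s in auto)
    then show "?t \<circ> \<sigma> \<in> {\<tau>. \<tau> permutes (V - {u} - {w})}" by simp
    have ne: "\<sigma> t \<noteq> u \<and> \<sigma> t \<noteq> w" if "t \<in> V - {u} - {w}" for t
      using that s by (metis DiffE insertI1 permutes_def)
    have "(\<Prod>t\<in>V. X t (\<sigma> t)) = X u w * (X w u * (\<Prod>t\<in>V - {u} - {w}. X t (\<sigma> t)))"
      using s assms prod.remove[of V u "\<lambda>t. X t (\<sigma> t)"] prod.remove[of "V - {u}" w "\<lambda>t. X t (\<sigma> t)"] by simp
    also have "(\<Prod>t\<in>V - {u} - {w}. X t (\<sigma> t)) = (\<Prod>t\<in>V - {u} - {w}. X t ((?t \<circ> \<sigma>) t))"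
      using ne by (intro prod.cong) (auto simp: Transposition.transpose_def)
    finally show "X u w * X w u * (\<Prod>t\<in>V - {u} - {w}. X t ((?t \<circ> \<sigma>) t)) = (\<Prod>t\<in>V. X t (\<sigma> t))"
      by simp
  next
    fix \<tau> assume "\<tau> \<in> {\<tau>. \<tau> permutes (V - {u} - {w})}"
    then have s: "\<tau> permutes (V - {u} - {w})" by auto
    show "?t \<circ> (?t \<circ> \<tau>) = \<tau>" by (simp add: fun_eq_iff)
    have "\<tau> permutes V" using s by (rule permutes_subset) auto
    then have "?t \<circ> \<tau> permutes V" using assms by (intro permutes_compose permutes_swap_id)
    then show "?t \<circ> \<tau> \<in> {\<sigma>. \<sigma> permutes V \<and> \<sigma> u = w \<and> \<sigma> w = u}"
      using s by (auto simp: permutes_not_in)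
  qed
  also have "\<dots> = X u w * X w u * per (V - {u} - {w}) X"
    by (simp add: per_def sum_distrib_left)
  finally show ?thesis using per_split[OF assms(1,2), of X] by simp
qed

lemma per_reindex:
  assumes f: "bij_betw f V W" and "\<And>i j. i \<in> V \<Longrightarrow> j \<in> V \<Longrightarrow> X i j = Y (f i) (f j)" and "finite V"
  shows "per V X = per W Y"
proof -
  define g where "g = inv_into V f"
  have g: "g (f x) = x" if "x \<in> V" for x using that f by (simp add: g_def bij_betw_def)
  have g': "g y \<in> V" "f (g y) = y" if "y \<in> W" for y
    using that f by (auto simp: g_def bij_betw_def inv_into_into f_inv_into_f)
  have fV: "f x \<in> W" if "x \<in> V" for x using that f bij_betwE by blast
  show ?thesis unfolding per_def
  proof (rule sum.reindex_bij_witness[of _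
      "\<lambda>\<tau> x. if x \<in> V then g (\<tau> (f x)) else x" "\<lambda>\<sigma> y. if y \<in> W then f (\<sigma> (g y)) else y"])
    fix \<sigma> assume "\<sigma> \<in> {\<sigma>. \<sigma> permutes V}"
    then have s: "\<sigma> permutes V" by simp
    show "(\<lambda>x. if x \<in> V then g (if f x \<in> W then f (\<sigma> (g (f x))) else f x) else x) = \<sigma>"
      using s by (auto simp: fun_eq_iff g fV permutes_in_image permutes_not_in)
    have "bij_betw (f \<circ> (\<sigma> \<circ> g)) W W"
      using bij_betw_inv_into[OF f] permutes_imp_bij[OF s] f unfolding g_def
      by (intro bij_betw_trans)
    then have "bij_betw (\<lambda>y. if y \<in> W then f (\<sigma> (g y)) else y) W W"
      by (rule bij_betw_cong[THEN iffD1, rotated]) auto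
    then show "(\<lambda>y. if y \<in> W then f (\<sigma> (g y)) else y) \<in> {\<tau>. \<tau> permutes W}"
      by (auto intro: bij_imp_permutes)
    show "(\<Prod>t\<in>W. Y t (if t \<in> W then f (\<sigma> (g t)) else t)) = (\<Prod>t\<in>V. X t (\<sigma> t))"
      using s by (subst prod.reindex_bij_betw[OF f, symmetric])
        (auto intro!: prod.cong simp: assms(2) g fV permutes_in_image)
  next
    fix \<tau> assume "\<tau> \<in> {\<tau>. \<tau> permutes W}"
    then have s: "\<tau> permutes W" by simp
    show "(\<lambda>y. if y \<in> W then f (if g y \<in> V then g (\<tau> (f (g y))) else g y) else y) = \<tau>"
      using s by (auto simp: fun_eq_iff g' permutes_in_image permutes_not_in)
    have "bij_betw (g \<circ> (\<tau> \<circ> f)) V V"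
      using bij_betw_inv_into[OF f] permutes_imp_bij[OF s] f unfolding g_def
      by (intro bij_betw_trans)
    then have "bij_betw (\<lambda>y. if y \<in> V then g (\<tau> (f y)) else y) V V"
      by (rule bij_betw_cong[THEN iffD1, rotated]) auto
    then show "(\<lambda>y. if y \<in> V then g (\<tau> (f y)) else y) \<in> {\<tau>. \<tau> permutes V}"
      by (auto intro: bij_imp_permutes)
  qed
qed

section \<open>Trees built by adding leaves\<close>

text \<open>The graph \<open>E\<close> stays fixed; trees are vertex sets whose induced subgraph is a tree, so that deleting
  a leaf only changes the set.\<close>

inductive tree_on :: "('a \<Rightarrow> 'a \<Rightarrow> bool) \<Rightarrow> 'a set \<Rightarrow> bool" for E where
  single: "tree_on E {r}"
| leaf: "tree_on E V \<Longrightarrow> x \<in> V \<Longrightarrow> u \<notin> V \<Longrightarrow> E u x \<Longrightarrow> (\<And>v. v \<in> V \<Longrightarrow> E u v \<Longrightarrow> v = x)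
    \<Longrightarrow> tree_on E (insert u V)"

definition deg :: "('a \<Rightarrow> 'a \<Rightarrow> bool) \<Rightarrow> 'a set \<Rightarrow> 'a \<Rightarrow> nat" where
  "deg E V v = card {j \<in> V. E v j}"

definition lap :: "('a \<Rightarrow> 'a \<Rightarrow> bool) \<Rightarrow> 'a set \<Rightarrow> 'a \<Rightarrow> 'a \<Rightarrow> int" where
  "lap E V i j = (if i = j then int (deg E V i) else if E i j then -1 else 0)"

text \<open>Degrees are taken in all of \<open>V\<close>; \<open>S\<close> only selects the deleted rows and columns.\<close>

definition plap :: "('a \<Rightarrow> 'a \<Rightarrow> bool) \<Rightarrow> 'a set \<Rightarrow> 'a set \<Rightarrow> int" where
  "plap E V S = per (V - S) (lap E V)"

locale bipartite_graph =
  fixes E :: "'a \<Rightarrow> 'a \<Rightarrow> bool" and A :: "'a set"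
  assumes sym: "E i j \<Longrightarrow> E j i"
    and bip: "E i j \<Longrightarrow> i \<in> A \<longleftrightarrow> j \<notin> A"
begin

lemma irrefl [simp]: "\<not> E i i"
  using bip[of i i] by auto

lemma swap: "bipartite_graph E (- A)"
  by unfold_locales (use sym bip in blast)+

lemma tree_on_finite: "tree_on E V \<Longrightarrow> finite V"
  by (induction rule: tree_on.induct) auto

lemma tree_on_nonempty: "tree_on E V \<Longrightarrow> V \<noteq> {}"
  by (induction rule: tree_on.induct) auto

text \<open>One attachment of the \<open>leaf\<close> rule as a predicate, so that attachments can
  be named, reordered and undone.\<close>

definition leaf_ext :: "'a set \<Rightarrow> 'a \<Rightarrow> 'a \<Rightarrow> bool" where
  "leaf_ext V x u \<longleftrightarrow> tree_on E V \<and> x \<in> V \<and> u \<notin> V \<and> E u x \<and> (\<forall>v\<in>V. E u v \<longrightarrow> v = x)"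

lemma leaf_extD:
  assumes "leaf_ext V x u"
  shows "tree_on E V" "finite V" "x \<in> V" "u \<notin> V" "u \<noteq> x" "E u x" "E x u"
    "v \<in> V \<Longrightarrow> E u v \<longleftrightarrow> v = x" "v \<in> V \<Longrightarrow> E v u \<longleftrightarrow> v = x"
proof -
  show *: "tree_on E V" "finite V" "x \<in> V" "u \<notin> V" "u \<noteq> x" "E u x"
    "v \<in> V \<Longrightarrow> E u v \<longleftrightarrow> v = x"
    using assms tree_on_finite[of V] by (auto simp: leaf_ext_def)
  then show "E x u" "v \<in> V \<Longrightarrow> E v u \<longleftrightarrow> v = x"
    using sym[of u v] sym[of v u] sym[of u x] by blast+
qed

lemma leaf_ext_tree_on: "leaf_ext V x u \<Longrightarrow> tree_on E (insert u V)"
  unfolding leaf_ext_def by (auto intro: tree_on.leaf)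

text \<open>Since \<open>x \<noteq> v\<close> keeps the second leaf off the first, the two
  attachments are independent. This is what allows a chosen leaf to be the last one added.\<close>

lemma leaf_ext_commute:
  assumes v: "leaf_ext V y v" and u: "leaf_ext (insert v V) x u" and "x \<noteq> v"
  shows "leaf_ext (insert u V) y v"
proof -
  note D = leaf_extD[OF v] and D' = leaf_extD[OF u]
  have nuv: "\<not> E v u" using D'(9)[of v] assms(3) by auto
  have "tree_on E (insert u V)"
    using D(1) D'(3,4,6,8) assms(3) by (intro tree_on.leaf[of _ _ x]) auto
  then show ?thesis using D'(4) D(3,4,6,8) nuv by (auto simp: leaf_ext_def)
qed

lemma leaf_ext_pair:
  assumes "leaf_ext {x} x u"
  shows "leaf_ext {u} u x" "insert u {x} = insert x {u}"
  using leaf_extD[OF assms] by (auto simp: leaf_ext_def intro: tree_on.single)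

text \<open>If \<open>w\<close> is itself the last leaf, with neighbour \<open>x\<close>, the
  induction hypothesis finds a leaf other than \<open>x\<close> in the rest, and that leaf can be
  moved past \<open>w\<close>. If the rest is only \<open>x\<close>, the two ends of the edge
  exchange roles.\<close>

lemma leaf_avoiding:
  assumes "tree_on E V" "w \<in> V" "V \<noteq> {w}"
  shows "\<exists>V' x u. leaf_ext V' x u \<and> V = insert u V' \<and> w \<in> V'"
  using assms
proof (induction arbitrary: w rule: tree_on.induct)
  case (single r)
  then show ?case by simp
next
  case (leaf V x u)
  have ext: "leaf_ext V x u" using leaf.hyps unfolding leaf_ext_def by blast
  show ?case
  proof (cases "w = u")
    case False
    then show ?thesis using ext leaf.prems by blast
  next
    case True
    show ?thesis
    proof (cases "V = {x}")
      case True
      then show ?thesis using leaf_ext_pair ext \<open>w = u\<close> by blast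
    next
      case False
      then obtain V' y v where v: "leaf_ext V' y v" "V = insert v V'" "x \<in> V'"
        using leaf.IH[of x] leaf.hyps(2) by blast
      moreover from this have "leaf_ext (insert u V') y v"
        using leaf_ext_commute[OF v(1)] ext leaf_extD(4) by blast
      moreover have "insert u V = insert v (insert u V')" using v(2) by auto
      ultimately show ?thesis using \<open>w = u\<close> by blast
    qed
  qed
qed

text \<open>A tree can be built up from any prescribed vertex \<open>w\<close>, so \<open>w\<close> need never be the removed leaf.\<close>

lemma tree_induct_avoiding [consumes 2, case_names single leaf]:
  assumes "tree_on E V" "w \<in> V"
    and "P {w}"
    and "\<And>V x u. leaf_ext V x u \<Longrightarrow> w \<in> V \<Longrightarrow> P V \<Longrightarrow> P (insert u V)"
  shows "P V"
  using assms(1,2)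
proof (induction "card V" arbitrary: V rule: less_induct)
  case less
  show ?case
  proof (cases "V = {w}")
    case True
    then show ?thesis using assms(3) by simp
  next
    case False
    then obtain V' x u where *: "leaf_ext V' x u" "V = insert u V'" "w \<in> V'"
      using leaf_avoiding[OF less.prems] by blast
    have "card V' < card V" using leaf_extD(2,4)[OF *(1)] *(2) by simp
    then have "P V'" using less.hyps[of V'] * leaf_extD(1) by blast
    then show ?thesis using assms(4)[OF *(1,3)] * by simp
  qed
qed

section \<open>Recurrence for attaching a leaf, and positivity\<close>

lemma deg_ext:
  assumes "leaf_ext V x u"
  shows "deg E (insert u V) u = 1" "deg E (insert u V) x = Suc (deg E V x)"
    "v \<in> V \<Longrightarrow> v \<noteq> x \<Longrightarrow> deg E (insert u V) v = deg E V v"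
proof -
  note * = leaf_extD[OF assms]
  have "{j \<in> insert u V. E u j} = {x}" using * by auto
  then show "deg E (insert u V) u = 1" by (simp add: deg_def)
  have "{j \<in> insert u V. E x j} = insert u {j \<in> V. E x j}" using * by auto
  then show "deg E (insert u V) x = Suc (deg E V x)" using * by (simp add: deg_def)
  show "deg E (insert u V) v = deg E V v" if "v \<in> V" "v \<noteq> x"
  proof -
    have "{j \<in> insert u V. E v j} = {j \<in> V. E v j}" using * that by auto
    then show ?thesis by (simp add: deg_def)
  qed
qed

text \<open>Attaching \<open>u\<close> raises the degree of \<open>x\<close> by one and admits the
  transposition of \<open>u\<close> and \<open>x\<close>, of weight \<open>(-1) * (-1) = 1\<close>.
  Each effect adds one copy of \<open>plap E V (insert x S)\<close>, whence the factor 2. If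
  \<open>u\<close> is deleted, only the first effect remains; if \<open>x\<close> is deleted,
  neither does.\<close>

lemma plap_ext:
  assumes "leaf_ext V x u"
  shows plap_ext_in: "x \<in> S \<Longrightarrow> plap E (insert u V) S = plap E V S"
    and plap_ext_leaf: "u \<in> S \<Longrightarrow> x \<notin> S \<Longrightarrow> plap E (insert u V) S = plap E V S + plap E V (insert x S)"
    and plap_ext_out: "u \<notin> S \<Longrightarrow> x \<notin> S \<Longrightarrow>
          plap E (insert u V) S = plap E V S + 2 * plap E V (insert x S)"
proof -
  let ?L = "lap E (insert u V)"
  note * = leaf_extD[OF assms]
  have L: "?L i j = lap E V i j" if "i \<in> V" "j \<in> V" "i \<noteq> x \<or> j \<noteq> x" for i j
    using that deg_ext(3)[OF assms, of i] by (auto simp: lap_def)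
  have Lx: "?L x x = lap E V x x + 1" by (simp add: lap_def deg_ext[OF assms])
  have Lu: "?L u u = 1" "?L u x = -1" "?L x u = -1"
    using * by (simp_all add: lap_def deg_ext[OF assms])
  have Lu0: "?L u j = 0" "?L j u = 0" if "j \<in> V" "j \<noteq> x" for j
    using * that by (auto simp: lap_def)
  have in_S: "per (V - T) ?L = plap E V T" if "x \<in> T" for T
    unfolding plap_def using that by (intro per_cong L) auto
  have out: "per (V - T) ?L = plap E V T + plap E V (insert x T)" if "x \<notin> T" for T
  proof -
    have "V - insert x T = V - T - {x}" by auto
    then show ?thesis using that * L Lx unfolding plap_def
      by (subst per_diag[of "V - T" x ?L "lap E V" 1]) auto
  qed
  have u_in: "plap E (insert u V) S = per (V - S) ?L" if "u \<in> S"
    unfolding plap_def using that by simp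
  have u_out: "insert u V - S - {u} = V - S" "insert u V - S - {u} - {x} = V - insert x S" if "u \<notin> S"
    using that * by auto
  show "plap E (insert u V) S = plap E V S" if "x \<in> S"
  proof (cases "u \<in> S")
    case False
    have "per (insert u V - S) ?L = ?L u u * per (insert u V - S - {u}) ?L"
      using * that False Lu0 by (intro per_isolated) auto
    then show ?thesis using that Lu u_out[OF False] in_S by (simp add: plap_def)
  qed (use u_in in_S that in simp)
  show "plap E (insert u V) S = plap E V S + plap E V (insert x S)" if "u \<in> S" "x \<notin> S"
    using that out u_in by simp
  show "plap E (insert u V) S = plap E V S + 2 * plap E V (insert x S)" if "u \<notin> S" "x \<notin> S"
  proof -
    have "per (insert u V - S) ?L = ?L u u * per (insert u V - S - {u}) ?L
        + ?L u x * ?L x u * per (insert u V - S - {u} - {x}) ?L"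
      using * that Lu0 by (intro per_leaf) auto
    then show ?thesis using that Lu u_out[OF that(1)] in_S[of "insert x S"] out[of S]
      by (simp add: plap_def[of E "insert u V"])
  qed
qed

lemma plap_nonneg: "tree_on E V \<Longrightarrow> 0 \<le> plap E V S"
proof -
  assume t: "tree_on E V"
  then obtain w where "w \<in> V" using tree_on_nonempty by blast
  with t show ?thesis
  proof (induction arbitrary: S rule: tree_induct_avoiding)
    case single
    have "0 \<le> per ({w} - S) (lap E {w})"
    proof (cases "w \<in> S")
      case False
      then have "{w} - S = {w}" by auto
      then show ?thesis using per_isolated[of "{w}" w "lap E {w}"] by (simp add: lap_def)
    qed simp
    then show ?case by (simp add: plap_def)
  next
    case (leaf V x u)
    then show ?case
      by (cases "x \<in> S"; cases "u \<in> S") (auto simp: plap_ext)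
  qed
qed

text \<open>The recurrence never lowers the value, and with \<open>w\<close> deleted it starts from
  the empty permanent 1. A single vertex that is not deleted would start from its degree 0.\<close>

lemma plap_pos: "tree_on E V \<Longrightarrow> w \<in> V \<Longrightarrow> w \<in> S \<Longrightarrow> 1 \<le> plap E V S"
proof (induction arbitrary: S rule: tree_induct_avoiding)
  case single
  then show ?case by (simp add: plap_def)
next
  case (leaf V x u)
  then have "tree_on E V" by (simp add: leaf_ext_def)
  then show ?case
    using leaf.IH[of S] leaf.prems leaf.hyps(1) plap_nonneg[of V "insert x S"]
    by (cases "x \<in> S"; cases "u \<in> S") (auto simp: plap_ext)
qed

end

section \<open>Lower bounds after deleting vertices\<close>

text \<open>Integer-valued, so that differences such as \<open>2 * cnt V A - 2\<close> are not
  truncated.\<close>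

definition cnt :: "'a set \<Rightarrow> 'a set \<Rightarrow> int" where
  "cnt V B = int (card (V \<inter> B))"

lemma cnt_insert: "finite V \<Longrightarrow> u \<notin> V \<Longrightarrow> cnt (insert u V) B = cnt V B + (if u \<in> B then 1 else 0)"
  by (simp add: cnt_def Int_insert_left)

lemma cnt_pos: "finite V \<Longrightarrow> v \<in> V \<Longrightarrow> v \<in> B \<Longrightarrow> 1 \<le> cnt V B"
  by (auto simp: cnt_def Suc_le_eq card_gt_0_iff)

context bipartite_graph
begin

section \<open>Degree sums over one class\<close>

lemma cnt_ext: "leaf_ext V x u \<Longrightarrow> cnt (insert u V) B = cnt V B + (if u \<in> B then 1 else 0)"
  using leaf_extD(2,4) by (simp add: cnt_insert)

lemma leaf_ext_side: "leaf_ext V x u \<Longrightarrow> u \<in> A \<longleftrightarrow> x \<notin> A"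
  using leaf_extD(6) bip by blast

text \<open>Every edge has exactly one end in \<open>A\<close>, so this counts the edges of the
  tree.\<close>

lemma sum_deg: "tree_on E V \<Longrightarrow> (\<Sum>v\<in>V \<inter> A. int (deg E V v)) = cnt V A + cnt V (- A) - 1"
proof -
  assume t: "tree_on E V"
  then obtain w where "w \<in> V" using tree_on_nonempty by blast
  with t show ?thesis
  proof (induction rule: tree_induct_avoiding)
    case single
    then show ?case by (cases "w \<in> A") (auto simp: cnt_def deg_def)
  next
    case (leaf V x u)
    note D = leaf_extD[OF leaf.hyps(1)] and d = deg_ext[OF leaf.hyps(1)]
    have side: "u \<in> A \<longleftrightarrow> x \<notin> A" using leaf.hyps(1) by (rule leaf_ext_side)
    have *: "finite (V \<inter> A)" using D by auto
    show ?case
    proof (cases "u \<in> A")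
      case True
      have "(\<Sum>v\<in>V \<inter> A. int (deg E (insert u V) v)) = (\<Sum>v\<in>V \<inter> A. int (deg E V v))"
      proof (intro sum.cong refl)
        fix v assume "v \<in> V \<inter> A"
        then show "int (deg E (insert u V) v) = int (deg E V v)"
          using True side d(3)[of v] by (cases "v = x") auto
      qed
      then show ?thesis using True D d * leaf.IH cnt_ext[OF leaf.hyps(1)]
        by (simp add: Int_insert_left)
    next
      case False
      have "(\<Sum>v\<in>V \<inter> A - {x}. int (deg E (insert u V) v)) = (\<Sum>v\<in>V \<inter> A - {x}. int (deg E V v))"
        using d(3) by (intro sum.cong) auto
      then show ?thesis using False D d * leaf.IH side cnt_ext[OF leaf.hyps(1)]
        by (simp add: Int_insert_left sum.remove[of "V \<inter> A" x])
    qed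
  qed
qed

lemma deg_pos: "tree_on E V \<Longrightarrow> v \<in> V \<Longrightarrow> V \<noteq> {v} \<Longrightarrow> 1 \<le> deg E V v"
proof (induction arbitrary: v rule: tree_on.induct)
  case (leaf V x u)
  have ext: "leaf_ext V x u" using leaf.hyps unfolding leaf_ext_def by blast
  then show ?case
    using deg_ext[OF ext] leaf_extD[OF ext] leaf.IH[of v] leaf.prems by (cases "v = x"; cases "v = u") auto
qed simp

text \<open>If the leaf added last hangs at \<open>u\<close>, degree 1 leaves nothing but that edge,
  whose ends may be exchanged. Otherwise \<open>u\<close> had degree 1 before, and the two
  attachments commute.\<close>

lemma leaf_removal:
  "tree_on E V \<Longrightarrow> u \<in> V \<Longrightarrow> deg E V u = 1 \<Longrightarrow> \<exists>V' w. leaf_ext V' w u \<and> V = insert u V'"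
proof (induction arbitrary: u rule: tree_on.induct)
  case (leaf V x v)
  have ext: "leaf_ext V x v" using leaf.hyps unfolding leaf_ext_def by blast
  note D = leaf_extD[OF ext]
  show ?case
  proof (cases "u = v \<or> u = x")
    case True
    have "V = {x}" if "u = x"
      using deg_pos[OF D(1,3)] deg_ext(2)[OF ext] leaf.prems(2) that by auto
    then show ?thesis using True ext leaf_ext_pair[of x v] by blast
  next
    case False
    then have "deg E V u = 1" using deg_ext(3)[OF ext, of u] leaf.prems by auto
    then obtain V' w where u: "leaf_ext V' w u" "V = insert u V'"
      using leaf.IH[of u] leaf.prems False by auto
    then have "leaf_ext (insert v V') w u" using leaf_ext_commute[OF u(1)] ext False by blast
    moreover have "insert v V = insert u (insert v V')" using u(2) by auto
    ultimately show ?thesis by blast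
  qed
next
  case (single r)
  have "{j \<in> {r}. E r j} = {}" by auto
  then have "deg E {r} r = 0" unfolding deg_def by (metis card.empty)
  then show ?case using single by simp
qed

lemma deg_le:
  assumes "tree_on E V" "c \<in> V" "c \<in> A"
  shows "int (deg E V c) \<le> cnt V (- A)"
proof -
  have "{j \<in> V. E c j} \<subseteq> V \<inter> - A" using assms bip by auto
  then show ?thesis using tree_on_finite[OF assms(1)] by (auto simp: deg_def cnt_def intro: card_mono)
qed

text \<open>In \<open>sum_deg\<close> each of the other \<open>cnt V A - 2\<close> vertices of the
  class takes at least 1.\<close>

lemma deg_sum2:
  assumes "tree_on E V" "c \<in> V" "c \<in> A" "w \<in> V" "w \<in> A" "c \<noteq> w"
  shows "int (deg E V c) + int (deg E V w) \<le> cnt V (- A) + 1"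
proof -
  have f: "finite (V \<inter> A)" using tree_on_finite[OF assms(1)] by simp
  have "(\<Sum>v\<in>V \<inter> A - {c} - {w}. 1) \<le> (\<Sum>v\<in>V \<inter> A - {c} - {w}. int (deg E V v))"
  proof (intro sum_mono)
    fix v assume "v \<in> V \<inter> A - {c} - {w}"
    then have "1 \<le> deg E V v" using assms by (intro deg_pos) auto
    then show "1 \<le> int (deg E V v)" by simp
  qed
  moreover have "(\<Sum>v\<in>V \<inter> A - {c} - {w}. 1) = cnt V A - 2"
  proof -
    have "card (V \<inter> A) = Suc (Suc (card (V \<inter> A - {c} - {w})))"
      using assms f card.remove[of "V \<inter> A" c] card.remove[of "V \<inter> A - {c}" w] by auto
    then show ?thesis by (simp add: cnt_def)
  qed
  moreover have "(\<Sum>v\<in>V \<inter> A. int (deg E V v)) = int (deg E V c) + (int (deg E V w)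
      + (\<Sum>v\<in>V \<inter> A - {c} - {w}. int (deg E V v)))"
    using assms f sum.remove[of "V \<inter> A" c "\<lambda>v. int (deg E V v)"]
      sum.remove[of "V \<inter> A - {c}" w "\<lambda>v. int (deg E V v)"] by auto
  ultimately show ?thesis using sum_deg[OF assms(1)] by linarith
qed

text \<open>\<open>deg_sum2\<close> leaves at most 1 for \<open>w\<close>. This rigidity makes trees
  with a full hub easy to describe.\<close>

lemma deg_full:
  assumes "tree_on E V" "c \<in> V" "c \<in> A" "int (deg E V c) = cnt V (- A)" "w \<in> V" "w \<in> A" "c \<noteq> w"
  shows "deg E V w = 1"
  using deg_sum2[OF assms(1-3,5-7)] deg_pos[OF assms(1,5)] assms by force

section \<open>Permanents with one or two vertices deleted\<close>

lemma plap_ge1: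
  "tree_on E V \<Longrightarrow> w \<in> V \<Longrightarrow> w \<in> A \<Longrightarrow> 2 * cnt V A - 1 \<le> plap E V {w}"
proof (induction rule: tree_induct_avoiding)
  case single
  then show ?case by (simp add: plap_def cnt_def)
next
  case (leaf V x u)
  note e = leaf.hyps(1)
  have n: "u \<notin> {w}" using leaf_extD(4)[OF e] leaf.hyps(2) by auto
  show ?case
  proof (cases "x = w")
    case True
    \<comment> \<open>A leaf at \<open>w\<close> gains nothing, but it lies outside
      \<open>A\<close>, so the bound does not grow either.\<close>
    then show ?thesis using plap_ext_in[OF e, of "{w}"] leaf cnt_ext[OF e, of A] leaf_ext_side[OF e] by simp
  next
    case False
    have "1 \<le> plap E V {x, w}" using leaf_extD[OF e] by (intro plap_pos[of V x]) auto
    then show ?thesis using plap_ext_out[OF e n] False leaf.IH leaf.prems cnt_ext[OF e, of A] by auto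
  qed
qed

lemma plap_outside: "u \<notin> V \<Longrightarrow> plap E V (insert u S) = plap E V S"
  by (simp add: plap_def)

text \<open>Feeds \<open>plap_deficit_aux\<close>: when a new vertex of the opposite class misses
  \<open>w\<close>, the bound there rises by exactly \<open>2 * (2 * cnt V A - 2)\<close>.\<close>

lemma plap_pair_ge:
  "tree_on E V \<Longrightarrow> w \<in> V \<Longrightarrow> w \<in> A \<Longrightarrow> x \<in> V \<Longrightarrow> x \<in> A \<Longrightarrow> x \<noteq> w \<Longrightarrow>
    2 * cnt V A - 2 \<le> plap E V {x, w}"
proof (induction rule: tree_induct_avoiding)
  case single
  then show ?case by simp
next
  case (leaf V y u)
  note e = leaf.hyps(1)
  note D = leaf_extD[OF e]
  have uw: "u \<noteq> w" using D(4) leaf.hyps(2) by auto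
  show ?case
  proof (cases "u = x")
    case True
    then have y: "y \<notin> {x, w}" using leaf_ext_side[OF e] leaf.prems D by auto
    \<comment> \<open>The deleted \<open>x\<close> is the new leaf, so the value is a sum of two
      terms over \<open>V\<close>, at least \<open>(2 * cnt V A - 1) + 1\<close>.\<close>
    have "2 * cnt V A - 1 \<le> plap E V {w}"
      using D leaf by (intro plap_ge1) auto
    moreover have "plap E V {x, w} = plap E V {w}"
      using D(4) True plap_outside by blast
    moreover have "1 \<le> plap E V (insert y {x, w})" using D by (intro plap_pos[of V y]) auto
    ultimately show ?thesis
      using plap_ext_leaf[OF e, of "{x, w}"] y True cnt_ext[OF e, of A] leaf.prems by auto
  next
    case False
    have IH: "2 * cnt V A - 2 \<le> plap E V {x, w}" using leaf.IH leaf.prems False by auto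
    show ?thesis
    proof (cases "y \<in> {x, w}")
      case True
      then have "u \<notin> A" using leaf_ext_side[OF e] leaf.prems by auto
      then show ?thesis using True IH plap_ext_in[OF e True] cnt_ext[OF e, of A] by simp
    next
      case y: False
      have "1 \<le> plap E V (insert y {x, w})" using D by (intro plap_pos[of V y]) auto
      then show ?thesis using plap_ext_out[OF e _ y] uw False IH cnt_ext[OF e, of A] by auto
    qed
  qed
qed

lemma deg_single:
  assumes "tree_on E V" "w \<in> V" "w \<in> A" "cnt V A = 1"
  shows "int (deg E V w) = cnt V (- A)"
proof -
  have "card (V \<inter> A) = 1" using assms(4) by (simp add: cnt_def)
  then have "V \<inter> A = {w}" using assms(2,3) by (metis IntI card_1_singletonE singletonD)
  then show ?thesis using sum_deg[OF assms(1)] assms(4) by simp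
qed

text \<open>The difference \<open>cnt V (- A) - int (deg E V w)\<close> is the number of opposite
  vertices that \<open>w\<close> misses. The two bounds need a joint induction: a new vertex of
  \<open>A\<close> raises the first by twice the second, and the second at a new vertex
  \<open>x\<close> outside \<open>A\<close> rests on the first.\<close>

lemma plap_deficit_aux:
  "tree_on E V \<Longrightarrow> w \<in> V \<Longrightarrow> w \<in> A \<Longrightarrow>
    (2 * cnt V A - 2) * (2 * (cnt V (- A) - int (deg E V w)) + 1) + 1 \<le> plap E V {w} \<and>
    (\<forall>x\<in>V. x \<notin> A \<longrightarrow> 2 * (cnt V (- A) - int (deg E V w)) + 1 \<le> plap E V {x, w})"
proof (induction rule: tree_induct_avoiding)
  case single
  then show ?case by (simp add: plap_def cnt_def)
next
  case (leaf V y u)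
  note e = leaf.hyps(1)
  note D = leaf_extD[OF e] and d = deg_ext[OF e]
  define p q t where "p = cnt V A" and "q = cnt V (- A)" and "t = q - int (deg E V w)"
  have uw: "u \<noteq> w" using D(4) leaf.hyps(2) by auto
  have t0: "0 \<le> t" using deg_le[OF D(1) leaf.hyps(2) leaf.prems] by (simp add: t_def q_def)
  have p1: "1 \<le> p" using cnt_pos D leaf by (simp add: p_def)
  have IH1: "(2 * p - 2) * (2 * t + 1) + 1 \<le> plap E V {w}"
    and IH2: "\<And>x. x \<in> V \<Longrightarrow> x \<notin> A \<Longrightarrow> 2 * t + 1 \<le> plap E V {x, w}"
    using leaf.IH[OF leaf.prems] by (auto simp: p_def q_def t_def)
  have uout: "plap E V (insert u S) = plap E V S" for S using D(4) by (rule plap_outside)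
  have p2: "2 * t + 1 \<le> (2 * p - 2) * (2 * t + 1) + 1" if "p \<noteq> 1"
  proof -
    have "1 * (2 * t + 1) \<le> (2 * p - 2) * (2 * t + 1)"
      using that p1 t0 by (intro mult_right_mono) auto
    then show ?thesis by simp
  qed
  consider (w) "y = w" "u \<notin> A" | (A) "y \<noteq> w" "u \<in> A" "y \<notin> A" | (B) "y \<noteq> w" "u \<notin> A" "y \<in> A"
    using leaf_ext_side[OF e] leaf.prems by auto
  then show ?case
  proof cases
    case w
    \<comment> \<open>Deleting \<open>w\<close> and its new leaf amounts to deleting
      \<open>w\<close> alone from \<open>V\<close>. For \<open>p = 1\<close> the first bound gives
      only 1, but then \<open>w\<close> misses nothing and \<open>t = 0\<close>.\<close>
    have "2 * t + 1 \<le> plap E V {w}"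
    proof (cases "p = 1")
      case True
      then have "t = 0" using deg_single[OF D(1) leaf.hyps(2) leaf.prems] by (simp add: t_def p_def q_def)
      then show ?thesis using IH1 True by simp
    qed (use p2 IH1 in simp)
    then show ?thesis
      using w IH1 IH2 leaf.prems d(2) plap_ext_in[OF e] cnt_ext[OF e] uout
      by (auto simp flip: p_def q_def simp: t_def)
  next
    case A
    have "2 * t + 1 \<le> plap E V {y, w}" using IH2 D A by auto
    then have "(2 * (p + 1) - 2) * (2 * t + 1) + 1 \<le> plap E (insert u V) {w}"
      using IH1 plap_ext_out[OF e, of "{w}"] A uw by (simp add: algebra_simps)
    moreover have "2 * t + 1 \<le> plap E (insert u V) {x, w}" if "x \<in> V" "x \<notin> A" for x
    proof (cases "x = y")
      case False
      moreover have "u \<noteq> x" using that D(4) by auto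
      ultimately show ?thesis using plap_ext_out[OF e, of "{x, w}"] A uw IH2[OF that] plap_nonneg[OF D(1), of "{y, x, w}"]
        by auto
    qed (use plap_ext_in[OF e] IH2 that in simp)
    ultimately show ?thesis using A d(3)[OF leaf.hyps(2)] cnt_ext[OF e]
      by (auto simp flip: p_def q_def simp: t_def)
  next
    case B
    have pr: "2 * p - 2 \<le> plap E V {y, w}"
      using plap_pair_ge[OF D(1) leaf.hyps(2) leaf.prems D(3)] B by (simp add: p_def)
    then have "(2 * p - 2) * (2 * (t + 1) + 1) + 1 \<le> plap E (insert u V) {w}"
      using IH1 plap_ext_out[OF e, of "{w}"] B uw by (simp add: algebra_simps)
    moreover have "2 * (t + 1) + 1 \<le> plap E (insert u V) {x, w}" if "x \<in> insert u V" "x \<notin> A" for x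
    proof (cases "x = u")
      case True
      have "p \<noteq> 1"
        using deg_single[OF D(1,3)] deg_sum2[OF D(1,3) B(3) leaf.hyps(2) leaf.prems B(1)]
          deg_single[OF D(1) leaf.hyps(2) leaf.prems] p_def B cnt_def
        by (metis IntI One_nat_def card_1_singletonE D(3) leaf.hyps(2) leaf.prems of_nat_1_eq_iff singletonD)
      then have "2 * (2 * t + 1) \<le> (2 * p - 2) * (2 * t + 1)"
        using p1 t0 by (intro mult_right_mono) auto
      moreover have "1 \<le> plap E V {y, w}" using D by (intro plap_pos[of V y]) auto
      ultimately show ?thesis
        using plap_ext_leaf[OF e, of "{x, w}"] True B D uout IH1 t0 insert_commute[of y u] by auto
    next
      case False
      have "1 \<le> plap E V {y, x, w}" using D by (intro plap_pos[of V y]) auto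
      moreover have "x \<noteq> y" using that B by auto
      ultimately show ?thesis using plap_ext_out[OF e, of "{x, w}"] B uw that False IH2[of x] by auto
    qed
    ultimately show ?thesis using B d(3)[OF leaf.hyps(2)] cnt_ext[OF e]
      by (auto simp flip: p_def q_def simp: t_def)
  qed
qed

lemma plap_deficit:
  assumes "tree_on E V" "w \<in> V" "w \<in> A"
  shows "(2 * cnt V A - 2) * (2 * (cnt V (- A) - int (deg E V w)) + 1) + 1 \<le> plap E V {w}"
  using plap_deficit_aux[OF assms] by blast

text \<open>The second bound is the first one for the complementary class, with \<open>x\<close> in
  the role of \<open>w\<close>.\<close>

lemma plap_edge_deficit:
  assumes "tree_on E V" "w \<in> V" "w \<in> A" "x \<in> V" "x \<notin> A"
  shows "2 * (cnt V (- A) - int (deg E V w)) + 1 \<le> plap E V {x, w}"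
    and "2 * (cnt V A - int (deg E V x)) + 1 \<le> plap E V {x, w}"
  using plap_deficit_aux[OF assms(1-3)] bipartite_graph.plap_deficit_aux[OF swap, of V x] assms
  by (auto simp: insert_commute)

text \<open>The constant is half of \<open>6 * (2 * cnt V A - 3)\<close>, the growth of the value at
  D' per vertex outside \<open>A\<close>. A new vertex of \<open>A\<close> at \<open>y\<close> has
  to contribute 6, that is, \<open>plap E V {y, w}\<close> has to be at least 3; this follows from
  the deficit bounds unless \<open>w\<close> and \<open>y\<close> are both full, and then the new
  tree has two full hubs again.\<close>

lemma plap_ge_or_double_star:
  "tree_on E V \<Longrightarrow> w \<in> V \<Longrightarrow> w \<in> A \<Longrightarrow> 6 * cnt V A - 9 \<le> plap E V {w} \<or>
    int (deg E V w) = cnt V (- A) \<and> (\<exists>x\<in>V. x \<notin> A \<and> int (deg E V x) = cnt V A)"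
proof (induction rule: tree_induct_avoiding)
  case single
  then show ?case by (simp add: plap_def cnt_def)
next
  case (leaf V y u)
  note e = leaf.hyps(1)
  note D = leaf_extD[OF e] and d = deg_ext[OF e]
  have uw: "u \<noteq> w" using D(4) leaf.hyps(2) by auto
  consider (w) "y = w" "u \<notin> A" | (A) "y \<noteq> w" "u \<in> A" "y \<notin> A" | (B) "y \<noteq> w" "u \<notin> A" "y \<in> A"
    using leaf_ext_side[OF e] leaf.prems by auto
  then show ?case
  proof cases
    case w
    have "deg E (insert u V) x = deg E V x" if "x \<in> V" "x \<notin> A" for x
      using d(3)[of x] that w leaf.prems by auto
    then show ?thesis using leaf.IH leaf.prems w plap_ext_in[OF e, of "{w}"] d(2) cnt_ext[OF e] by auto
  next
    case A
    have pl: "plap E (insert u V) {w} = plap E V {w} + 2 * plap E V {y, w}"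
      using plap_ext_out[OF e, of "{w}"] A uw by simp
    have cn: "cnt (insert u V) A = cnt V A + 1" "cnt (insert u V) (- A) = cnt V (- A)"
      "deg E (insert u V) w = deg E V w" "deg E (insert u V) y = Suc (deg E V y)"
      using cnt_ext[OF e] A d(2) d(3)[OF leaf.hyps(2)] by auto
    have ed: "2 * (cnt V (- A) - int (deg E V w)) + 1 \<le> plap E V {y, w}"
      "2 * (cnt V A - int (deg E V y)) + 1 \<le> plap E V {y, w}"
      using plap_edge_deficit[OF D(1) leaf.hyps(2) leaf.prems D(3)] A by auto
    show ?thesis
    proof (cases "int (deg E V w) = cnt V (- A) \<and> int (deg E V y) = cnt V A")
      case True
      then show ?thesis using cn D(3) A by auto
    next
      case F: False
      have le: "int (deg E V w) \<le> cnt V (- A)" "int (deg E V y) \<le> cnt V A"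
        using deg_le[OF D(1) leaf.hyps(2) leaf.prems] bipartite_graph.deg_le[OF swap D(1,3)] A by auto
      have "6 * cnt V A - 9 + 6 \<le> plap E V {w} + 2 * plap E V {y, w}"
      proof (cases "6 * cnt V A - 9 \<le> plap E V {w}")
        case True
        moreover have "3 \<le> plap E V {y, w}"
          using F ed le by (cases "int (deg E V w) = cnt V (- A)") auto
        ultimately show ?thesis by simp
      next
        case False
        then obtain x where x: "x \<in> V" "x \<notin> A" "int (deg E V x) = cnt V A" "int (deg E V w) = cnt V (- A)"
          using leaf.IH leaf.prems by auto
        \<comment> \<open>\<open>V\<close> is a double star and \<open>y\<close> is not a hub, so
          \<open>y\<close> is a leaf missing \<open>cnt V A - 1\<close> vertices. Its deficit bound
          and \<open>plap_ge1\<close> together give \<open>3 * (2 * cnt V A - 1)\<close>, exactly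
          the required value.\<close>
        then have "x \<noteq> y" using F by auto
        then have "deg E V y = 1"
          using bipartite_graph.deg_full[OF swap D(1) x(1) _ _ D(3)] x A by auto
        then show ?thesis using ed plap_ge1[OF D(1) leaf.hyps(2) leaf.prems] by simp
      qed
      then show ?thesis using pl cn by simp
    qed
  next
    case B
    \<comment> \<open>Now \<open>w\<close> misses \<open>u\<close>, and one missed vertex already
      gives \<open>6 * cnt V A - 5\<close>.\<close>
    have "int (deg E (insert u V) w) + 1 \<le> cnt (insert u V) (- A)"
      using d(3)[OF leaf.hyps(2)] B cnt_ext[OF e] deg_le[OF D(1) leaf.hyps(2) leaf.prems] by auto
    moreover have "1 \<le> cnt V A" using cnt_pos D leaf by simp
    ultimately have "(2 * cnt (insert u V) A - 2) * 3
        \<le> (2 * cnt (insert u V) A - 2) * (2 * (cnt (insert u V) (- A) - int (deg E (insert u V) w)) + 1)"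
      using B cnt_ext[OF e] by (intro mult_left_mono) auto
    then show ?thesis
      using plap_deficit[of "insert u V" w] leaf_ext_tree_on[OF e] leaf by auto
  qed
qed

end

section \<open>Graphs described by vertex classes\<close>

lemma per_insert_leaf:
  assumes "finite W" "u \<notin> W" "w \<in> W"
    and "\<And>j. j \<in> W \<Longrightarrow> j \<noteq> w \<Longrightarrow> X u j = 0 \<and> X j u = 0"
  shows "per (insert u W) X = X u u * per W X + X u w * X w u * per (W - {w}) X"
  using assms per_leaf[of "insert u W" u w X] by auto

lemma per_insert_isolated:
  assumes "finite W" "u \<notin> W" and "\<And>j. j \<in> W \<Longrightarrow> X u j = 0"
  shows "per (insert u W) X = X u u * per W X"
  using assms per_isolated[of "insert u W" u X] by auto

text \<open>The matrix is fixed here and \<open>X x x\<close> is not adjusted when leaves are added,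
  so each leaf contributes \<open>per (W - {x}) X\<close> only once, through its transposition with
  \<open>x\<close>, not twice as in \<open>plap_ext\<close>. Without \<open>x\<close> the leaves are
  isolated with diagonal entry 1.\<close>

lemma per_leaves:
  assumes "finite L" "finite W" "L \<inter> W = {}" "x \<in> W"
    and "\<And>u. u \<in> L \<Longrightarrow> X u u = 1 \<and> X u x = -1 \<and> X x u = -1"
    and "\<And>u j. u \<in> L \<Longrightarrow> j \<in> W \<union> L \<Longrightarrow> j \<noteq> u \<Longrightarrow> j \<noteq> x \<Longrightarrow> X u j = 0 \<and> X j u = 0"
  shows "per (W \<union> L) X = per W X + int (card L) * per (W - {x}) X"
    and "per (W - {x} \<union> L) X = per (W - {x}) X"
proof -
  have "per (W \<union> K) X = per W X + int (card K) * per (W - {x}) X \<and>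
      per (W - {x} \<union> K) X = per (W - {x}) X" if "K \<subseteq> L" for K
    using finite_subset[OF that assms(1)] that
  proof (induction K rule: finite_induct)
    case (insert u K)
    have d: "insert u (W \<union> K) - {u} = W \<union> K" using insert assms(3) by auto
    have e: "W \<union> K - {x} = W - {x} \<union> K" using insert assms(3,4) by auto
    have fin: "finite (W \<union> K)" using insert assms by auto
    have n: "u \<notin> W \<union> K" using insert assms(3) by auto
    have z: "X u j = 0 \<and> X j u = 0" if "j \<in> W \<union> K" "j \<noteq> x" for j
      using assms(6)[of u j] that n insert by auto
    have "per (insert u (W \<union> K)) X = X u u * per (W \<union> K) X + X u x * X x u * per (W \<union> K - {x}) X"
      using fin n z assms(4) by (intro per_insert_leaf) auto
    moreover have "per (insert u (W - {x} \<union> K)) X = X u u * per (W - {x} \<union> K) X"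
      using fin n z e by (intro per_insert_isolated) auto
    ultimately show ?case using insert e assms(5)[of u] by (auto simp: algebra_simps)
  qed simp
  then show "per (W \<union> L) X = per W X + int (card L) * per (W - {x}) X"
    "per (W - {x} \<union> L) X = per (W - {x}) X" by auto
qed

lemma per_two_hubs:
  assumes "finite K" "finite L" "finite M" "L \<inter> K = {}" "M \<inter> K = {}" "L \<inter> M = {}"
    "x \<in> K" "c \<in> K" "x \<noteq> c"
    and "\<And>u. u \<in> L \<Longrightarrow> X u u = 1 \<and> X u x = -1 \<and> X x u = -1"
    and "\<And>u. u \<in> M \<Longrightarrow> X u u = 1 \<and> X u c = -1 \<and> X c u = -1"
    and "\<And>u j. u \<in> L \<Longrightarrow> j \<in> K \<union> M \<union> L \<Longrightarrow> j \<noteq> u \<Longrightarrow> j \<noteq> x \<Longrightarrow> X u j = 0 \<and> X j u = 0"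
    and "\<And>u j. u \<in> M \<Longrightarrow> j \<in> K \<union> M \<union> L \<Longrightarrow> j \<noteq> u \<Longrightarrow> j \<noteq> c \<Longrightarrow> X u j = 0 \<and> X j u = 0"
  shows "per (K \<union> M \<union> L) X = per K X + int (card M) * per (K - {c}) X
    + int (card L) * (per (K - {x}) X + int (card M) * per (K - {x} - {c}) X)"
proof -
  have "per (K \<union> M \<union> L) X = per (K \<union> M) X + int (card L) * per (K \<union> M - {x}) X"
    using assms by (intro per_leaves(1)) auto
  also have "K \<union> M - {x} = K - {x} \<union> M" using assms by auto
  also have "per (K - {x} \<union> M) X = per (K - {x}) X + int (card M) * per (K - {x} - {c}) X"
    using assms by (intro per_leaves(1)) auto
  also have "per (K \<union> M) X = per K X + int (card M) * per (K - {c}) X"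
    using assms by (intro per_leaves(1)) auto
  finally show ?thesis .
qed

text \<open>\<open>V\<close> splits into classes of sizes \<open>ms\<close>, and adjacency depends on the classes alone, through \<open>R\<close>.\<close>

definition shape :: "(nat \<Rightarrow> nat \<Rightarrow> bool) \<Rightarrow> nat list \<Rightarrow> 'a set \<Rightarrow> ('a \<Rightarrow> 'a \<Rightarrow> bool) \<Rightarrow> bool" where
  "shape R ms V E \<longleftrightarrow> (\<exists>cls. (\<forall>i\<in>V. \<forall>j\<in>V. E i j \<longleftrightarrow> R (cls i) (cls j)) \<and>
     (\<forall>k. card {i \<in> V. cls i = k} = (if k < length ms then ms ! k else 0)))"

text \<open>Classes with equal index have equal size, so bijections between them glue together. All
  isomorphisms below are obtained by comparing shapes.\<close>

lemma shape_iso: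
  assumes "shape R ms V E" "shape R ms W F" "finite V" "finite W"
  shows "\<exists>f. bij_betw f V W \<and> (\<forall>i\<in>V. \<forall>j\<in>V. E i j \<longleftrightarrow> F (f i) (f j))"
proof -
  obtain a where a: "\<And>i j. i \<in> V \<Longrightarrow> j \<in> V \<Longrightarrow> E i j \<longleftrightarrow> R (a i) (a j)"
    "\<And>k. card {i \<in> V. a i = k} = (if k < length ms then ms ! k else 0)"
    using assms(1) unfolding shape_def by blast
  obtain b where b: "\<And>i j. i \<in> W \<Longrightarrow> j \<in> W \<Longrightarrow> F i j \<longleftrightarrow> R (b i) (b j)"
    "\<And>k. card {i \<in> W. b i = k} = (if k < length ms then ms ! k else 0)"
    using assms(2) unfolding shape_def by blast
  have "\<exists>h. bij_betw h {i \<in> V. a i = k} {i \<in> W. b i = k}" for k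
    using a(2) b(2) assms(3,4) by (intro finite_same_card_bij) auto
  then obtain h where h: "\<And>k. bij_betw (h k) {i \<in> V. a i = k} {i \<in> W. b i = k}" by metis
  let ?f = "\<lambda>i. h (a i) i"
  have f: "?f i \<in> W \<and> b (?f i) = a i" if "i \<in> V" for i
    using bij_betwE[OF h[of "a i"]] that by auto
  have "inj_on ?f V"
  proof (rule inj_onI)
    fix i j assume *: "i \<in> V" "j \<in> V" "?f i = ?f j"
    then have "a i = a j" using f by metis
    then show "i = j" using * bij_betw_imp_inj_on[OF h[of "a i"]] by (auto dest: inj_onD)
  qed
  moreover have "?f ` V = W"
  proof
    show "W \<subseteq> ?f ` V"
    proof
      fix y assume "y \<in> W"
      then have "y \<in> h (b y) ` {i \<in> V. a i = b y}" using bij_betw_imp_surj_on[OF h[of "b y"]] by auto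
      then obtain i where "i \<in> V" "a i = b y" "y = h (b y) i" by auto
      then show "y \<in> ?f ` V" by (intro image_eqI[of _ _ i]) auto
    qed
  qed (use f in auto)
  ultimately have "bij_betw ?f V W" by (simp add: bij_betw_def)
  moreover have "E i j \<longleftrightarrow> F (?f i) (?f j)" if "i \<in> V" "j \<in> V" for i j
    using a(1) b(1) f that by auto
  ultimately show ?thesis by blast
qed

definition symrel :: "(nat \<times> nat) set \<Rightarrow> nat \<Rightarrow> nat \<Rightarrow> bool" where
  "symrel S k l \<longleftrightarrow> (k, l) \<in> S \<or> (l, k) \<in> S"

lemma shape_classes:
  assumes "shape R ms V E" "finite V"
  obtains C where "\<And>i j k l. i \<in> C k \<Longrightarrow> j \<in> C l \<Longrightarrow> i \<noteq> j \<Longrightarrow> lap E V i j = (if R k l then -1 else 0)"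
    "\<And>i k. i \<in> C k \<Longrightarrow> deg E V i = card (\<Union>l\<in>{l. R k l}. C l)"
    "\<And>k l. k \<noteq> l \<Longrightarrow> C k \<inter> C l = {}" "V = (\<Union>k<length ms. C k)"
    "\<And>k. finite (C k)" "\<And>k. card (C k) = (if k < length ms then ms ! k else 0)"
proof -
  obtain a where a: "\<And>i j. i \<in> V \<Longrightarrow> j \<in> V \<Longrightarrow> E i j \<longleftrightarrow> R (a i) (a j)"
    "\<And>k. card {i \<in> V. a i = k} = (if k < length ms then ms ! k else 0)"
    using assms unfolding shape_def by blast
  have lt: "a i < length ms" if "i \<in> V" for i
    using a(2)[of "a i"] that assms(2) by (force split: if_splits)
  show thesis
  proof (rule that[of "\<lambda>k. {i \<in> V. a i = k}"])
    show "deg E V i = card (\<Union>l\<in>{l. R k l}. {i \<in> V. a i = l})" if "i \<in> {i \<in> V. a i = k}" for i k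
    proof -
      have "{j \<in> V. E i j} = (\<Union>l\<in>{l. R k l}. {i \<in> V. a i = l})" using a(1) that by auto
      then show ?thesis by (simp add: deg_def)
    qed
  qed (use a assms lt in \<open>auto simp: lap_def\<close>)
qed

text \<open>Classes 0 and 1 are the hubs, 2 and 3 their pendant vertices, and 4, 5 the pendant path
  of length 2 at hub 1.\<close>

definition near_double_star_rel :: "nat \<Rightarrow> nat \<Rightarrow> bool" where
  "near_double_star_rel = symrel {(0, 1), (0, 2), (1, 3), (1, 4), (4, 5)}"

text \<open>Classes 0, 1, 2 form the path \<open>P_3\<close> of \<open>T(n,3,a)\<close>; 3 and 4 are
  the pendant vertices at its two ends.\<close>

definition broom_rel :: "nat \<Rightarrow> nat \<Rightarrow> bool" where
  "broom_rel = symrel {(0, 1), (1, 2), (0, 3), (2, 4)}"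

lemma per_near_double_star:
  assumes "shape near_double_star_rel [1, 1, a, b, 1, 1] V E" "finite V"
  shows "per V (lap E V) = (2 * int a + 1) * (6 * int b + 7) + 3"
proof -
  let ?X = "lap E V"
  let ?ms = "[1, 1, a, b, 1, 1]"
  from assms obtain C where
      off: "\<And>i j k l. i \<in> C k \<Longrightarrow> j \<in> C l \<Longrightarrow> i \<noteq> j \<Longrightarrow> ?X i j = (if near_double_star_rel k l then -1 else 0)"
    and deg: "\<And>i k. i \<in> C k \<Longrightarrow> deg E V i = card (\<Union>l\<in>{l. near_double_star_rel k l}. C l)"
    and disj: "\<And>k l. k \<noteq> l \<Longrightarrow> C k \<inter> C l = {}" and V: "V = (\<Union>k<length ?ms. C k)"
    and fin: "\<And>k. finite (C k)" and card: "\<And>k. card (C k) = (if k < length ?ms then ?ms ! k else 0)"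
    by (rule shape_classes) blast
  have cards: "card (C 0) = 1" "card (C 1) = 1" "card (C 2) = a" "card (C 3) = b" "card (C 4) = 1" "card (C 5) = 1"
    by (simp_all add: card del: One_nat_def)
  then obtain x c z y where s: "C 0 = {x}" "C 1 = {c}" "C 4 = {z}" "C 5 = {y}"
    by (meson card_1_singletonE)
  note R = near_double_star_rel_def symrel_def
  have "{..<length ?ms} = {0, 1, 2, 3, 4, 5}" by auto
  then have V: "V = {x, c, z, y} \<union> C 3 \<union> C 2" using V s by auto
  have nb: "{l. near_double_star_rel 0 l} = {1, 2}" "{l. near_double_star_rel 1 l} = {0, 3, 4}"
    "{l. near_double_star_rel 2 l} = {0}" "{l. near_double_star_rel 3 l} = {1}"
    "{l. near_double_star_rel 4 l} = {1, 5}" "{l. near_double_star_rel 5 l} = {4}"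
    by (auto simp: R)
  have ne: "x \<noteq> c" "x \<noteq> z" "x \<noteq> y" "c \<noteq> z" "c \<noteq> y" "z \<noteq> y"
    using disj[of 0 1] disj[of 0 4] disj[of 0 5] disj[of 1 4] disj[of 1 5] disj[of 4 5] s by auto
  have nC: "x \<notin> C 2" "c \<notin> C 2" "z \<notin> C 2" "y \<notin> C 2" "C 2 \<inter> C 3 = {}" "x \<notin> C 3" "c \<notin> C 3" "z \<notin> C 3" "y \<notin> C 3"
    using disj[of 0 2] disj[of 1 2] disj[of 4 2] disj[of 5 2] disj[of 2 3]
      disj[of 0 3] disj[of 1 3] disj[of 4 3] disj[of 5 3] s by auto
  have diag: "?X x x = int a + 1" "?X c c = int b + 2" "?X z z = 2" "?X y y = 1"
    "\<And>u. u \<in> C 2 \<Longrightarrow> ?X u u = 1" "\<And>u. u \<in> C 3 \<Longrightarrow> ?X u u = 1"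
    using deg[of x 0] deg[of c 1] deg[of z 4] deg[of y 5] deg[of _ 2] deg[of _ 3] s ne nC fin cards
    by (simp_all add: lap_def nb del: One_nat_def)
  have core: "?X x c = -1" "?X c x = -1" "?X c z = -1" "?X z c = -1" "?X z y = -1" "?X y z = -1"
    "?X x z = 0" "?X z x = 0" "?X x y = 0" "?X y x = 0" "?X c y = 0" "?X y c = 0"
    using ne s off[of x 0 c 1] off[of c 1 x 0] off[of c 1 z 4] off[of z 4 c 1] off[of z 4 y 5] off[of y 5 z 4]
      off[of x 0 z 4] off[of z 4 x 0] off[of x 0 y 5] off[of y 5 x 0] off[of c 1 y 5] off[of y 5 c 1]
    by (simp_all add: R)
  have xL: "?X u x = -1" "?X x u = -1" if "u \<in> C 2" for u
    using that nC s off[of u 2 x 0] off[of x 0 u 2] by (auto simp: R)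
  have cL: "?X u c = -1" "?X c u = -1" if "u \<in> C 3" for u
    using that nC s off[of u 3 c 1] off[of c 1 u 3] by (auto simp: R)
  have mem: "\<exists>l. j \<in> C l" if "j \<in> V" for j using that V s by blast
  have zL: "?X u j = 0" "?X j u = 0" if u: "u \<in> C 2" "j \<in> V" "j \<noteq> u" "j \<noteq> x" for u j
  proof -
    obtain l where "j \<in> C l" using mem[OF u(2)] by blast
    moreover from this have "l \<noteq> 0" using u s by (auto intro!: gr0I)
    ultimately show "?X u j = 0" "?X j u = 0" using u off[of u 2 j l] off[of j l u 2] by (auto simp: R)
  qed
  have zK: "?X u j = 0" "?X j u = 0" if u: "u \<in> C 3" "j \<in> V" "j \<noteq> u" "j \<noteq> c" for u j
  proof -
    obtain l where "j \<in> C l" using mem[OF u(2)] by blast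
    moreover from this have "l \<noteq> 1" using u s by auto
    ultimately show "?X u j = 0" "?X j u = 0" using u off[of u 3 j l] off[of j l u 3] by (auto simp: R)
  qed
  \<comment> \<open>Stripping the leaves at the hubs \<open>x\<close> and \<open>c\<close> leaves
    minors on the path \<open>x\<close>, \<open>c\<close>, \<open>z\<close>, \<open>y\<close>, with
    the full degrees kept on the diagonal.\<close>
  have "per V ?X = per {x, c, z, y} ?X + int b * per ({x, c, z, y} - {c}) ?X
      + int a * (per ({x, c, z, y} - {x}) ?X + int b * per ({x, c, z, y} - {x} - {c}) ?X)"
  proof -
    have "per ({x, c, z, y} \<union> C 3 \<union> C 2) ?X = per {x, c, z, y} ?X + int (card (C 3)) * per ({x, c, z, y} - {c}) ?X
      + int (card (C 2)) * (per ({x, c, z, y} - {x}) ?X + int (card (C 3)) * per ({x, c, z, y} - {x} - {c}) ?X)"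
    proof (rule per_two_hubs)
      show "?X u j = 0 \<and> ?X j u = 0" if "u \<in> C 2" "j \<in> {x, c, z, y} \<union> C 3 \<union> C 2" "j \<noteq> u" "j \<noteq> x" for u j
        using zL[of u j] that V by blast
      show "?X u j = 0 \<and> ?X j u = 0" if "u \<in> C 3" "j \<in> {x, c, z, y} \<union> C 3 \<union> C 2" "j \<noteq> u" "j \<noteq> c" for u j
        using zK[of u j] that V by blast
    qed (use fin nC ne diag xL cL in auto)
    then show ?thesis unfolding V(1)[symmetric] cards .
  qed
  also have "{x, c, z, y} - {c} = {x, z, y}" using ne by auto
  also have "{x, c, z, y} - {x} = {c, z, y}" using ne by auto
  also have "{c, z, y} - {c} = {z, y}" using ne by auto
  also have "per {x, c, z, y} ?X = (int a + 1) * per {c, z, y} ?X + per {z, y} ?X"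
  proof -
    have "per (insert x {c, z, y}) ?X = ?X x x * per {c, z, y} ?X + ?X x c * ?X c x * per ({c, z, y} - {c}) ?X"
      using ne by (intro per_insert_leaf) (auto simp: core)
    then show ?thesis by (simp add: \<open>{c, z, y} - {c} = {z, y}\<close> diag core)
  qed
  also have "per {x, z, y} ?X = (int a + 1) * per {z, y} ?X"
    using ne by (subst per_insert_isolated) (auto simp: diag core insert_Diff_if)
  also have "per {c, z, y} ?X = (int b + 2) * per {z, y} ?X + per {y} ?X"
    using ne by (subst per_insert_leaf[where w = z]) (auto simp: diag core insert_Diff_if)
  also have "per {z, y} ?X = 2 * per {y} ?X + 1"
    using ne by (subst per_insert_leaf[where w = y]) (auto simp: diag core insert_Diff_if)
  also have "per {y} ?X = 1"
    using per_insert_isolated[of "{}" y ?X] by (auto simp: diag core)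
  finally show ?thesis by (simp add: algebra_simps)
qed

text \<open>The value equals \<open>8 * a * b + 6 * (a + b) + 4\<close>, so among trees of equal
  order it is governed by the product \<open>a * b\<close>.\<close>

lemma per_broom:
  assumes "shape broom_rel [1, 1, 1, a, b] V E" "finite V"
  shows "per V (lap E V) = 2 * (2 * int a + 1) * (2 * int b + 1) + (2 * int a + 1) + (2 * int b + 1)"
proof -
  let ?X = "lap E V"
  let ?ms = "[1, 1, 1, a, b]"
  from assms obtain C where
      off: "\<And>i j k l. i \<in> C k \<Longrightarrow> j \<in> C l \<Longrightarrow> i \<noteq> j \<Longrightarrow> ?X i j = (if broom_rel k l then -1 else 0)"
    and deg: "\<And>i k. i \<in> C k \<Longrightarrow> deg E V i = card (\<Union>l\<in>{l. broom_rel k l}. C l)"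
    and disj: "\<And>k l. k \<noteq> l \<Longrightarrow> C k \<inter> C l = {}" and V: "V = (\<Union>k<length ?ms. C k)"
    and fin: "\<And>k. finite (C k)" and card: "\<And>k. card (C k) = (if k < length ?ms then ?ms ! k else 0)"
    by (rule shape_classes) blast
  have cards: "card (C 0) = 1" "card (C 1) = 1" "card (C 2) = 1" "card (C 3) = a" "card (C 4) = b"
    by (simp_all add: card del: One_nat_def)
  then obtain x z c where s: "C 0 = {x}" "C 1 = {z}" "C 2 = {c}"
    by (meson card_1_singletonE)
  note R = broom_rel_def symrel_def
  have "{..<length ?ms} = {0, 1, 2, 3, 4}" by auto
  then have V: "V = {x, c, z} \<union> C 4 \<union> C 3" using V s by auto
  have nb: "{l. broom_rel 0 l} = {1, 3}" "{l. broom_rel 1 l} = {0, 2}" "{l. broom_rel 2 l} = {1, 4}"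
    "{l. broom_rel 3 l} = {0}" "{l. broom_rel 4 l} = {2}"
    by (auto simp: R)
  have ne: "x \<noteq> c" "x \<noteq> z" "c \<noteq> z"
    using disj[of 0 1] disj[of 0 2] disj[of 1 2] s by auto
  have nC: "x \<notin> C 3" "c \<notin> C 3" "z \<notin> C 3" "C 3 \<inter> C 4 = {}" "x \<notin> C 4" "c \<notin> C 4" "z \<notin> C 4"
    using disj[of 0 3] disj[of 1 3] disj[of 2 3] disj[of 3 4] disj[of 0 4] disj[of 1 4] disj[of 2 4] s by auto
  have diag: "?X x x = int a + 1" "?X c c = int b + 1" "?X z z = 2"
    "\<And>u. u \<in> C 3 \<Longrightarrow> ?X u u = 1" "\<And>u. u \<in> C 4 \<Longrightarrow> ?X u u = 1"
    using deg[of x 0] deg[of z 1] deg[of c 2] deg[of _ 3] deg[of _ 4] s ne nC fin cards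
    by (simp_all add: lap_def nb del: One_nat_def)
  have core: "?X x z = -1" "?X z x = -1" "?X c z = -1" "?X z c = -1" "?X x c = 0" "?X c x = 0"
    using ne s off[of x 0 z 1] off[of z 1 x 0] off[of c 2 z 1] off[of z 1 c 2] off[of x 0 c 2] off[of c 2 x 0]
    by (simp_all add: R)
  have xL: "?X u x = -1" "?X x u = -1" if "u \<in> C 3" for u
    using that nC s off[of u 3 x 0] off[of x 0 u 3] by (auto simp: R)
  have cL: "?X u c = -1" "?X c u = -1" if "u \<in> C 4" for u
    using that nC s off[of u 4 c 2] off[of c 2 u 4] by (auto simp: R)
  have mem: "\<exists>l. j \<in> C l" if "j \<in> V" for j using that V s by blast
  have zL: "?X u j = 0" "?X j u = 0" if u: "u \<in> C 3" "j \<in> V" "j \<noteq> u" "j \<noteq> x" for u j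
  proof -
    obtain l where "j \<in> C l" using mem[OF u(2)] by blast
    moreover from this have "l \<noteq> 0" using u s by (auto intro!: gr0I)
    ultimately show "?X u j = 0" "?X j u = 0" using u off[of u 3 j l] off[of j l u 3] by (auto simp: R)
  qed
  have zK: "?X u j = 0" "?X j u = 0" if u: "u \<in> C 4" "j \<in> V" "j \<noteq> u" "j \<noteq> c" for u j
  proof -
    obtain l where "j \<in> C l" using mem[OF u(2)] by blast
    moreover from this have "l \<noteq> 2" using u s by auto
    ultimately show "?X u j = 0" "?X j u = 0" using u off[of u 4 j l] off[of j l u 4] by (auto simp: R)
  qed
  have "per V ?X = per {x, c, z} ?X + int b * per ({x, c, z} - {c}) ?X
      + int a * (per ({x, c, z} - {x}) ?X + int b * per ({x, c, z} - {x} - {c}) ?X)"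
  proof -
    have "per ({x, c, z} \<union> C 4 \<union> C 3) ?X = per {x, c, z} ?X + int (card (C 4)) * per ({x, c, z} - {c}) ?X
      + int (card (C 3)) * (per ({x, c, z} - {x}) ?X + int (card (C 4)) * per ({x, c, z} - {x} - {c}) ?X)"
    proof (rule per_two_hubs)
      show "?X u j = 0 \<and> ?X j u = 0" if "u \<in> C 3" "j \<in> {x, c, z} \<union> C 4 \<union> C 3" "j \<noteq> u" "j \<noteq> x" for u j
        using zL[of u j] that V by blast
      show "?X u j = 0 \<and> ?X j u = 0" if "u \<in> C 4" "j \<in> {x, c, z} \<union> C 4 \<union> C 3" "j \<noteq> u" "j \<noteq> c" for u j
        using zK[of u j] that V by blast
    qed (use fin nC ne diag xL cL in auto)
    then show ?thesis unfolding V(1)[symmetric] cards .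
  qed
  also have "{x, c, z} - {c} = {x, z}" using ne by auto
  also have "{x, c, z} - {x} = {c, z}" using ne by auto
  also have "{c, z} - {c} = {z}" using ne by auto
  also have "per {x, c, z} ?X = (int a + 1) * per {c, z} ?X + per {c} ?X"
  proof -
    have "{c, z} - {z} = {c}" using ne by auto
    then show ?thesis using ne by (subst per_insert_leaf[where w = z]) (auto simp: diag core insert_Diff_if)
  qed
  also have "per {x, z} ?X = (int a + 1) * per {z} ?X + 1"
    using ne by (subst per_insert_leaf[where w = z]) (auto simp: diag core insert_Diff_if)
  also have "per {c, z} ?X = (int b + 1) * per {z} ?X + 1"
    using ne by (subst per_insert_leaf[where w = z]) (auto simp: diag core insert_Diff_if)
  also have "per {z} ?X = 2" using per_insert_isolated[of "{}" z ?X] by (auto simp: diag)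
  also have "per {c} ?X = int b + 1" using per_insert_isolated[of "{}" c ?X] by (auto simp: diag)
  finally show ?thesis by (simp add: algebra_simps)
qed

section \<open>Exceptional trees\<close>

text \<open>\<open>hubs E A V 0 0\<close>, \<open>hubs E A V 0 1\<close> and \<open>hubs E A V 1 0\<close> describe \<open>D\<close>, \<open>D'\<close> and \<open>D''\<close>, with \<open>V \<inter> A\<close> as
  the class of size \<open>p\<close>.\<close>

definition hubs :: "('a \<Rightarrow> 'a \<Rightarrow> bool) \<Rightarrow> 'a set \<Rightarrow> 'a set \<Rightarrow> int \<Rightarrow> int \<Rightarrow> bool" where
  "hubs E A V i j \<longleftrightarrow> (\<exists>c\<in>V \<inter> A. \<exists>x\<in>V \<inter> - A.
     int (deg E V c) = cnt V (- A) - i \<and> int (deg E V x) = cnt V A - j)"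

lemma hubs_swap: "hubs E (- A) V i j \<longleftrightarrow> hubs E A V j i"
  unfolding hubs_def by auto

text \<open>The larger of the values at \<open>D'\<close> and \<open>D''\<close>, symmetric in the two class sizes.\<close>

definition hbound :: "int \<Rightarrow> int \<Rightarrow> int" where
  "hbound p q = max ((2 * q - 3) * (6 * p - 5) + 3) ((2 * p - 3) * (6 * q - 5) + 3)"

lemma hbound_commute: "hbound p q = hbound q p"
  by (simp add: hbound_def max.commute)

lemma hbound_le: "p \<le> q \<Longrightarrow> hbound p q = (2 * q - 3) * (6 * p - 5) + 3"
  by (simp add: hbound_def algebra_simps)

context bipartite_graph
begin

definition exceptional :: "'a set \<Rightarrow> bool" where
  "exceptional V \<longleftrightarrow> hubs E A V 0 0 \<or> hubs E A V 0 1 \<or> hubs E A V 1 0"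

lemma nbr_unique:
  assumes "deg E V v = 1" "a \<in> V" "b \<in> V" "E v a" "E v b"
  shows "a = b"
proof -
  obtain z where "{j \<in> V. E v j} = {z}" using assms(1) unfolding deg_def by (auto simp: card_1_singleton_iff)
  then show ?thesis using assms by (metis (mono_tags, lifting) mem_Collect_eq singletonD)
qed

lemma full_adj:
  assumes "finite V" "c \<in> A" "int (deg E V c) = cnt V (- A)" "x \<in> V" "x \<notin> A"
  shows "E c x"
proof -
  have "{j \<in> V. E c j} = V \<inter> - A"
    using assms bip by (intro card_subset_eq) (auto simp: deg_def cnt_def)
  then show ?thesis using assms by auto
qed

lemma bipartite_shapeI:
  assumes "\<And>i j. i \<in> V \<Longrightarrow> j \<in> V \<Longrightarrow> i \<in> A \<Longrightarrow> j \<notin> A \<Longrightarrow> E i j \<longleftrightarrow> symrel S (cls i) (cls j)"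
    and "\<And>i j. i \<in> V \<Longrightarrow> j \<in> V \<Longrightarrow> (i \<in> A \<longleftrightarrow> j \<in> A) \<Longrightarrow> \<not> symrel S (cls i) (cls j)"
    and "\<And>k. card {i \<in> V. cls i = k} = (if k < length ms then ms ! k else 0)"
  shows "shape (symrel S) ms V E"
proof -
  have "E i j \<longleftrightarrow> symrel S (cls i) (cls j)" if "i \<in> V" "j \<in> V" for i j
  proof (cases "i \<in> A \<longleftrightarrow> j \<in> A")
    case True
    then show ?thesis using assms(2)[OF that] bip[of i j] by auto
  next
    case False
    then consider "i \<in> A" "j \<notin> A" | "j \<in> A" "i \<notin> A" by auto
    then show ?thesis
    proof cases
      case 2
      have "E i j \<longleftrightarrow> E j i" using sym by blast
      also have "\<dots> \<longleftrightarrow> symrel S (cls j) (cls i)" using assms(1) 2 that by auto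
      finally show ?thesis by (auto simp: symrel_def)
    qed (use assms(1) that in auto)
  qed
  then show ?thesis using assms(3) unfolding shape_def by blast
qed

text \<open>As \<open>c\<close> is full, every other vertex of \<open>A\<close> is a leaf, and as
  \<open>x\<close> is full, that leaf hangs at \<open>x\<close>. The class sizes therefore determine
  the tree.\<close>

lemma shape_double_star:
  assumes t: "tree_on E V" and "hubs E A V 0 0"
  shows "shape (symrel {(0, 1), (0, 2), (1, 3)})
    [1, 1, card (V \<inter> A) - 1, card (V \<inter> - A) - 1] V E"
proof -
  obtain c x where c: "c \<in> V" "c \<in> A" "int (deg E V c) = cnt V (- A)"
    and x: "x \<in> V" "x \<notin> A" "int (deg E V x) = cnt V A"
    using assms(2) unfolding hubs_def by auto
  have fin: "finite V" using t by (rule tree_on_finite)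
  have cA: "E c j" if "j \<in> V" "j \<notin> A" for j using full_adj[OF fin c(2,3)] that by blast
  have xA: "E x j" if "j \<in> V" "j \<in> A" for j
    using bipartite_graph.full_adj[OF swap fin _ _ that(1), of x] that x by auto
  define cls :: "'a \<Rightarrow> nat" where "cls i = (if i = x then 0 else if i = c then 1 else if i \<in> A then 2 else 3)" for i
  have "{i \<in> V. cls i = k} = (if k = 0 then {x} else if k = 1 then {c} else if k = 2 then V \<inter> A - {c}
      else if k = 3 then V \<inter> - A - {x} else {})" for k
    using c x by (auto simp: cls_def)
  then have "card {i \<in> V. cls i = k} = (if k < length [1, 1, card (V \<inter> A) - 1, card (V \<inter> - A) - 1]
      then [1, 1, card (V \<inter> A) - 1, card (V \<inter> - A) - 1] ! k else 0)" for k
    using c x fin by (auto simp: nth_Cons' card_Diff_singleton)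
  moreover have "E i j \<longleftrightarrow> symrel {(0, 1), (0, 2), (1, 3)} (cls i) (cls j)"
    if ij: "i \<in> V" "j \<in> V" "i \<in> A" "j \<notin> A" for i j
  proof -
    have "E i x" using xA[of i] sym ij by blast
    moreover have "i = c" if "E i j" "j \<noteq> x"
    proof (rule ccontr)
      assume "i \<noteq> c"
      then have "deg E V i = 1" using deg_full[OF t c(1,2,3)] ij by auto
      then show False using nbr_unique[of V i j x] \<open>E i x\<close> that ij x by auto
    qed
    ultimately have "E i j \<longleftrightarrow> i = c \<or> j = x" using cA ij by blast
    then show ?thesis using ij c(2) x(2) by (auto simp: cls_def symrel_def)
  qed
  moreover have "\<not> symrel {(0, 1), (0, 2), (1, 3)} (cls i) (cls j)"
    if "i \<in> V" "j \<in> V" "i \<in> A \<longleftrightarrow> j \<in> A" for i j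
    using that c(2) x(2) by (auto simp: cls_def symrel_def)
  ultimately show ?thesis by (intro bipartite_shapeI[of V _ cls]) auto
qed

text \<open>As \<open>c\<close> is full, the other vertices of \<open>A\<close> are leaves. All but
  one of them hang at \<open>x\<close>; the exception \<open>y\<close> hangs at some
  \<open>z\<close>, which is joined to \<open>c\<close>, so \<open>y\<close> ends the pendant path.
  The pairs \<open>c\<close>, \<open>y\<close> and \<open>x\<close>, \<open>z\<close> give the size
  bounds.\<close>

lemma shape_near_double_star:
  assumes t: "tree_on E V" and "hubs E A V 0 1"
  shows "shape near_double_star_rel
      [1, 1, card (V \<inter> A) - 2, card (V \<inter> - A) - 2, 1, 1] V E"
    and "2 \<le> card (V \<inter> A)" "2 \<le> card (V \<inter> - A)"
proof -
  obtain c x where c: "c \<in> V" "c \<in> A" "int (deg E V c) = cnt V (- A)"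
    and x: "x \<in> V" "x \<notin> A" "int (deg E V x) = cnt V A - 1"
    using assms(2) unfolding hubs_def by auto
  have fin: "finite V" using t by (rule tree_on_finite)
  have cA: "E c j" if "j \<in> V" "j \<notin> A" for j using full_adj[OF fin c(2,3)] that by blast
  have leaf: "deg E V i = 1" if "i \<in> V" "i \<in> A" "i \<noteq> c" for i
    using deg_full[OF t c that(1,2)] that(3) by auto
  let ?N = "{j \<in> V. E x j}"
  have N: "?N \<subseteq> V \<inter> A" using x bip by auto
  have "card (V \<inter> A - ?N) = 1"
    using card_Diff_subset[OF _ N] fin x(3) card_gt_0_iff[of "V \<inter> A"] c by (auto simp: deg_def cnt_def)
  then obtain y where y: "V \<inter> A - ?N = {y}" by (auto simp: card_1_singleton_iff)
  then have yV: "y \<in> V" "y \<in> A" "\<not> E x y" by auto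
  have "E x c" using cA x sym by blast
  then have yc: "y \<noteq> c" using yV by auto
  have xA: "E j x" if "j \<in> V" "j \<in> A" "j \<noteq> y" for j
    using that y sym[of x j] by auto
  have "deg E V y = 1" using leaf yV yc by auto
  then obtain z where z: "{j \<in> V. E y j} = {z}" unfolding deg_def by (auto simp: card_1_singleton_iff)
  then have zV: "z \<in> V" "E y z" by auto
  then have zA: "z \<notin> A" "z \<noteq> x" using bip yV sym by blast+
  have "card {c, y} \<le> card (V \<inter> A)" "card {x, z} \<le> card (V \<inter> - A)"
    by (rule card_mono; use fin c yV x zV zA in auto)+
  moreover have "card {c, y} = 2" "card {x, z} = 2" using yc zA(2) by auto
  ultimately show c2: "2 \<le> card (V \<inter> A)" "2 \<le> card (V \<inter> - A)" by linarith+
  define cls :: "'a \<Rightarrow> nat" where "cls i = (if i = x then 0 else if i = c then 1 else if i = z then 4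
    else if i = y then 5 else if i \<in> A then 2 else 3)" for i
  let ?ms = "[1, 1, card (V \<inter> A) - 2, card (V \<inter> - A) - 2, 1, 1]"
  have "{i \<in> V. cls i = k} = (if k = 0 then {x} else if k = 1 then {c} else if k = 2 then V \<inter> A - {c, y}
      else if k = 3 then V \<inter> - A - {x, z} else if k = 4 then {z} else if k = 5 then {y} else {})" for k
    using c x yV zV zA yc by (auto simp: cls_def)
  moreover have "card (V \<inter> A - {c, y}) = card (V \<inter> A) - 2" "card (V \<inter> - A - {x, z}) = card (V \<inter> - A) - 2"
    using c x yV zV zA yc fin by (auto simp: card_Diff_subset)
  ultimately have "card {i \<in> V. cls i = k} = (if k < length ?ms then ?ms ! k else 0)" for k
    by (auto simp: nth_Cons')
  moreover have "E i j \<longleftrightarrow> symrel {(0, 1), (0, 2), (1, 3), (1, 4), (4, 5)} (cls i) (cls j)"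
    if ij: "i \<in> V" "j \<in> V" "i \<in> A" "j \<notin> A" for i j
  proof -
    consider "i = c" | "i = y" | "i \<noteq> c" "i \<noteq> y" by blast
    then show ?thesis
    proof cases
      case 1
      then have "E i j" using cA ij by blast
      then show ?thesis using 1 ij c(2) x(2) zA yV yc by (auto simp: cls_def symrel_def)
    next
      case 2
      have "E y j \<longleftrightarrow> j = z" using z ij by auto
      then show ?thesis using 2 ij yc yV c(2) x(2) zA by (auto simp: cls_def symrel_def)
    next
      case 3
      have "E i j \<longleftrightarrow> j = x" using nbr_unique[OF leaf[OF ij(1,3) 3(1)]] xA[OF ij(1,3) 3(2)] ij x by blast
      then show ?thesis using 3 ij x(2) zA c(2) yV by (auto simp: cls_def symrel_def)
    qed
  qed
  moreover have "\<not> symrel {(0, 1), (0, 2), (1, 3), (1, 4), (4, 5)} (cls i) (cls j)"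
    if "i \<in> V" "j \<in> V" "i \<in> A \<longleftrightarrow> j \<in> A" for i j
    using that c(2) x(2) yV zA by (auto simp: cls_def symrel_def)
  ultimately show "shape near_double_star_rel ?ms V E"
    unfolding near_double_star_rel_def by (intro bipartite_shapeI[of V _ cls]) auto
qed

lemma plap_hubs01:
  assumes t: "tree_on E V" and "hubs E A V 0 1"
  shows "plap E V {} = (2 * cnt V A - 3) * (6 * cnt V (- A) - 5) + 3"
  using per_near_double_star[OF shape_near_double_star(1)[OF assms] tree_on_finite[OF t]]
    shape_near_double_star(2,3)[OF assms]
  by (simp add: plap_def cnt_def of_nat_diff algebra_simps)

text \<open>The degrees outside \<open>A\<close> are at most 2 and sum to one more than the number
  of these vertices.\<close>

lemma deg_two_exists:
  assumes "tree_on E V" "cnt V A = 2"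
  shows "\<exists>x\<in>V \<inter> - A. int (deg E V x) = 2"
proof -
  interpret s: bipartite_graph E "- A" by (rule swap)
  have fin: "finite V" using assms(1) by (rule tree_on_finite)
  have le: "int (deg E V x) \<le> 2" if "x \<in> V \<inter> - A" for x
    using s.deg_le[OF assms(1), of x] that assms(2) by simp
  show ?thesis
  proof (rule ccontr)
    assume "\<not> ?thesis"
    then have "(\<Sum>v\<in>V \<inter> - A. int (deg E V v)) \<le> (\<Sum>v\<in>V \<inter> - A. 1)"
      using le by (intro sum_mono) force
    then show False using s.sum_deg[OF assms(1)] assms(2) by (simp add: cnt_def)
  qed
qed

end

section \<open>The lower bound for the remaining trees\<close>

context bipartite_graph
begin

text \<open>The induction step for a new leaf outside \<open>A\<close>. By \<open>cond\<close> its
  class ends up no larger than \<open>A\<close>, or strictly larger while \<open>A\<close> has no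
  leaf.\<close>

lemma plap_ext_bound:
  assumes e: "leaf_ext V w u" and u: "u \<notin> A"
    and p2: "2 \<le> cnt V A" and q2: "2 \<le> cnt V (- A)"
    and ne: "\<not> exceptional (insert u V)"
    and IH: "\<not> exceptional V \<Longrightarrow> hbound (cnt V A) (cnt V (- A)) < plap E V {}"
    and cond: "cnt V (- A) < cnt V A \<or>
      (cnt V A \<le> cnt V (- A) \<and> (\<forall>v\<in>V \<inter> A. 2 \<le> deg E (insert u V) v))"
  shows "hbound (cnt V A) (cnt V (- A) + 1) < plap E (insert u V) {}"
proof -
  note D = leaf_extD[OF e] and d = deg_ext[OF e]
  have w: "w \<in> A" using leaf_ext_side[OF e] u by blast
  define p q where "p = cnt V A" and "q = cnt V (- A)"
  have cn: "cnt (insert u V) A = p" "cnt (insert u V) (- A) = q + 1"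
    using cnt_ext[OF e] u by (auto simp: p_def q_def)
  have pl: "plap E (insert u V) {} = plap E V {} + 2 * plap E V {w}"
    using plap_ext_out[OF e, of "{}"] by simp
  have "V \<noteq> {w}"
  proof
    assume "V = {w}"
    then have "V \<inter> - A = {}" using w by auto
    then show False using q2 by (simp add: cnt_def)
  qed
  then have dw: "int (deg E V w) \<le> q" "1 \<le> deg E V w"
    using deg_le[OF D(1,3) w] deg_pos[OF D(1,3)] by (auto simp: q_def)
  have hubsI: "hubs E A (insert u V) i j"
    if "c \<in> V" "c \<in> A" "x \<in> V" "x \<notin> A" "int (deg E (insert u V) c) = q + 1 - i" "int (deg E V x) = p - j"
    for c x i j
  proof -
    have "deg E (insert u V) x = deg E V x" using d(3)[OF that(3)] that(4) w by auto
    then show ?thesis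
      unfolding hubs_def cn by (intro bexI[of _ c] bexI[of _ x]) (use that in auto)
  qed
  \<comment> \<open>A double star stays exceptional: a leaf at the hub in \<open>A\<close> keeps
    both hubs full, and elsewhere that hub misses only \<open>u\<close>.\<close>
  have nd: "\<not> hubs E A V 0 0"
  proof
    assume "hubs E A V 0 0"
    then obtain c x where c: "c \<in> V" "c \<in> A" "x \<in> V" "x \<notin> A" "int (deg E V c) = q" "int (deg E V x) = p"
      unfolding hubs_def p_def q_def by auto
    then have "hubs E A (insert u V) (if c = w then 0 else 1) 0"
      using d(2) d(3)[OF c(1)] by (intro hubsI[OF c(1-4)]) auto
    then show False using ne unfolding exceptional_def by (auto split: if_splits)
  qed
  define t where "t = q - int (deg E V w)"
  have def: "(2 * p - 2) * (2 * t + 1) + 1 \<le> plap E V {w}"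
    using plap_deficit[OF D(1,3) w] by (simp add: p_def q_def t_def)
  have mono: "(2 * p - 2) * (2 * k + 1) + 1 \<le> plap E V {w}" if "k \<le> t" for k
  proof -
    have "(2 * p - 2) * (2 * k + 1) \<le> (2 * p - 2) * (2 * t + 1)"
      using that p2 by (intro mult_left_mono) (auto simp: p_def)
    then show ?thesis using def by simp
  qed
  have hq: "hbound p (q + 1) = (if p \<le> q then (2 * q - 1) * (6 * p - 5) + 3 else (2 * p - 3) * (6 * q + 1) + 3)"
    using hbound_le[of p "q + 1"] hbound_le[of "q + 1" p] by (auto simp: hbound_commute)
  show ?thesis
  proof (cases "exceptional V")
    case False
    have IH': "hbound p q < plap E V {}" using IH False by (simp add: p_def q_def)
    show ?thesis
    proof (cases "q < p")
      case True
      have "6 * p - 9 \<le> plap E V {w}"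
        using plap_ge_or_double_star[OF D(1,3) w] nd D(3) w unfolding hubs_def p_def q_def by auto
      then show ?thesis using IH' hbound_le[of q p] True hq pl
        by (simp add: p_def[symmetric] q_def[symmetric] hbound_commute algebra_simps)
    next
      case pq: False
      then have all2: "2 \<le> deg E (insert u V) v" if "v \<in> V" "v \<in> A" for v
        using cond that by (auto simp: p_def q_def)
      have "int (deg E V w) \<noteq> q"
      proof
        assume *: "int (deg E V w) = q"
        have "\<exists>v\<in>V \<inter> A. v \<noteq> w"
        proof (rule ccontr)
          assume "\<not> ?thesis"
          then have "V \<inter> A = {w}" using D(3) w by blast
          then show False using p2 by (simp add: cnt_def)
        qed
        then obtain v where v: "v \<in> V" "v \<in> A" "v \<noteq> w" by blast
        then have "deg E V v = 1" using deg_full[OF D(1,3) w _ v(1,2)] * by (simp add: q_def)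
        then show False using d(3)[OF v(1,3)] all2[OF v(1,2)] by simp
      qed
      then have "1 \<le> t" using dw by (simp add: t_def)
      from mono[OF this] show ?thesis using IH' hbound_le[of p q] pq hq pl
        by (simp add: p_def[symmetric] q_def[symmetric] algebra_simps)
    qed
  next
    case True
    then consider "hubs E A V 0 1" | "hubs E A V 1 0" using nd unfolding exceptional_def by blast
    then show ?thesis
    proof cases
      case 1
      then obtain c x where c: "c \<in> V" "c \<in> A" "x \<in> V" "x \<notin> A" "int (deg E V c) = q" "int (deg E V x) = p - 1"
        unfolding hubs_def p_def q_def by auto
      \<comment> \<open>At the full hub, \<open>u\<close> would preserve the deficits 0 and 1. Hence
        \<open>w\<close> is another vertex of \<open>A\<close>, a leaf of \<open>V\<close>, and
        misses \<open>q - 1\<close> vertices.\<close>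
      have "c \<noteq> w"
      proof
        assume "c = w"
        then have "hubs E A (insert u V) 0 1" using d(2) c by (intro hubsI[OF c(1-4)]) auto
        then show False using ne unfolding exceptional_def by blast
      qed
      then have "deg E V w = 1" using deg_full[OF D(1) c(1,2) _ D(3) w] c by (auto simp: q_def)
      then have "q - 1 \<le> t" by (simp add: t_def)
      note A = mono[OF this]
      \<comment> \<open>For \<open>p = 2\<close> a vertex of degree 2 outside \<open>A\<close> is
        full, and with \<open>c\<close> it would make \<open>V\<close> a double star.\<close>
      have "p \<noteq> 2"
      proof
        assume "p = 2"
        then obtain x' where "x' \<in> V \<inter> - A" "int (deg E V x') = p"
          using deg_two_exists[OF D(1)] by (auto simp: p_def)
        then have "hubs E A V 0 0" using c unfolding hubs_def by (auto simp: p_def q_def)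
        then show False using nd by blast
      qed
      then have p3: "3 \<le> p" using p2 by (simp add: p_def)
      have "plap E V {} = (2 * p - 3) * (6 * q - 5) + 3"
        using plap_hubs01[OF D(1) 1] by (simp add: p_def q_def)
      then have *: "(2 * p - 3) * (6 * q - 5) + 3 + 2 * ((2 * p - 2) * (2 * q - 1) + 1) \<le> plap E (insert u V) {}"
        using A pl by simp
      \<comment> \<open>After this substitution the difference of the two sides is a polynomial in
        \<open>m\<close> and \<open>k\<close> with nonnegative coefficients and positive constant
        term.\<close>
      obtain m k where "p = 3 + int m" "q = 2 + int k"
        using p3 q2 by (metis q_def zle_iff_zadd)
      then have "hbound p (q + 1) < (2 * p - 3) * (6 * q - 5) + 3 + 2 * ((2 * p - 2) * (2 * q - 1) + 1)"
        unfolding hq by (auto simp: algebra_simps intro!: add_pos_nonneg add_nonneg_nonneg)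
      then show ?thesis using * by (simp add: p_def q_def)
    next
      case 2
      then obtain c x where c: "c \<in> V" "c \<in> A" "x \<in> V" "x \<notin> A" "int (deg E V c) = q - 1" "int (deg E V x) = p"
        unfolding hubs_def p_def q_def by auto
      \<comment> \<open>Such a \<open>w\<close> would gain \<open>u\<close>, still miss one vertex,
        and together with \<open>x\<close> show deficits 1 and 0. Since a full \<open>w\<close>
        would make \<open>V\<close> a double star, \<open>w\<close> misses at least two
        vertices.\<close>
      have "int (deg E V w) \<noteq> q - 1"
      proof
        assume "int (deg E V w) = q - 1"
        then have "hubs E A (insert u V) 1 0" using d(2) c by (intro hubsI[OF D(3) w c(3,4)]) auto
        then show False using ne unfolding exceptional_def by blast
      qed
      moreover have "int (deg E V w) \<noteq> q"
      proof
        assume "int (deg E V w) = q"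
        then have "hubs E A V 0 0" using c D(3) w unfolding hubs_def by (auto simp: p_def q_def)
        then show False using nd by blast
      qed
      ultimately have "2 \<le> t" using dw by (simp add: t_def)
      note A = mono[OF this]
      have "plap E V {} = (2 * q - 3) * (6 * p - 5) + 3"
        using bipartite_graph.plap_hubs01[OF swap D(1)] 2 by (simp add: p_def q_def hubs_swap)
      then have *: "(2 * q - 3) * (6 * p - 5) + 3 + 2 * ((2 * p - 2) * 5 + 1) \<le> plap E (insert u V) {}"
        using A pl by simp
      have "hbound p (q + 1) < (2 * q - 3) * (6 * p - 5) + 3 + 2 * ((2 * p - 2) * 5 + 1)"
        using p2 q2 unfolding hq by (simp add: p_def[symmetric] q_def[symmetric] algebra_simps)
      then show ?thesis using * by (simp add: p_def q_def)
    qed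
  qed
qed

lemma exceptional_swap: "bipartite_graph.exceptional E (- A) V = exceptional V"
  unfolding bipartite_graph.exceptional_def[OF swap] exceptional_def by (auto simp: hubs_swap)

text \<open>By the degree sum the other vertex of the pair is full, and some vertex outside
  \<open>A\<close> is joined to both. Hence no leaf of a non-exceptional tree lies in a class of
  size 2, and the induction never shrinks a class below 2.\<close>

lemma leaf_in_pair:
  assumes t: "tree_on E V" and "cnt V A = 2" and u: "u \<in> V" "u \<in> A" "deg E V u = 1"
  shows "hubs E A V 0 0"
proof -
  have "card (V \<inter> A) = 2" using assms(2) by (simp add: cnt_def)
  then obtain a b where "V \<inter> A = {a, b}" "a \<noteq> b" by (auto simp: card_2_iff)
  then obtain c where c: "V \<inter> A = {c, u}" "c \<noteq> u" using u by (cases "u = a") auto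
  then have "int (deg E V c) = cnt V (- A)" using sum_deg[OF t] assms(2) u by simp
  then show ?thesis using deg_two_exists[OF t assms(2)] c assms(2) unfolding hubs_def by auto
qed

text \<open>The degree sum \<open>cnt V A + cnt V (- A) - 1\<close> is at least
  \<open>2 * cnt V A\<close>. Consequently a class at least as large as the other one contains a
  leaf.\<close>

lemma min_deg_two:
  assumes "tree_on E V" "\<And>v. v \<in> V \<Longrightarrow> v \<in> A \<Longrightarrow> 2 \<le> deg E V v"
  shows "cnt V A < cnt V (- A)"
proof -
  have "(\<Sum>v\<in>V \<inter> A. 2) \<le> (\<Sum>v\<in>V \<inter> A. int (deg E V v))"
    using assms(2) by (intro sum_mono) force
  then show ?thesis using sum_deg[OF assms(1)] by (simp add: cnt_def)
qed

lemma plap_bound_step: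
  assumes t: "tree_on E V" and le: "cnt V (- A) \<le> cnt V A" and q2: "2 \<le> cnt V (- A)" and ne: "\<not> exceptional V"
    and IH: "\<And>W. tree_on E W \<Longrightarrow> card W < card V \<Longrightarrow> 2 \<le> cnt W A \<Longrightarrow> 2 \<le> cnt W (- A) \<Longrightarrow>
      \<not> exceptional W \<Longrightarrow> hbound (cnt W A) (cnt W (- A)) < plap E W {}"
  shows "hbound (cnt V A) (cnt V (- A)) < plap E V {}"
proof -
  interpret s: bipartite_graph E "- A" by (rule swap)
  have pos: "1 \<le> deg E V v" if "v \<in> V" for v
  proof (rule deg_pos[OF t that])
    show "V \<noteq> {v}"
    proof
      assume "V = {v}"
      then show False using q2 le by (cases "v \<in> A") (auto simp: cnt_def)
    qed
  qed
  show ?thesis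
  proof (cases "\<exists>u\<in>V. u \<notin> A \<and> deg E V u = 1")
    case True
    then obtain u where u: "u \<in> V" "u \<notin> A" "deg E V u = 1" by blast
    have "cnt V (- A) \<noteq> 2"
      using s.leaf_in_pair[OF t _ u(1) _ u(3)] u(2) ne by (auto simp: exceptional_def hubs_swap)
    then have q3: "3 \<le> cnt V (- A)" using q2 by simp
    obtain W w where W: "leaf_ext W w u" "V = insert u W" using leaf_removal[OF t u(1,3)] by blast
    have c: "cnt V A = cnt W A" "cnt V (- A) = cnt W (- A) + 1" using cnt_ext[OF W(1)] W(2) u by auto
    have "card W < card V" using leaf_extD(2,4)[OF W(1)] W(2) by simp
    then have "hbound (cnt W A) (cnt W (- A)) < plap E W {}" if "\<not> exceptional W"
      using IH[OF leaf_extD(1)[OF W(1)]] c le q3 that by simp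
    then show ?thesis using plap_ext_bound[OF W(1) u(2)] c le q3 ne W(2) by simp
  next
    case False
    have two: "2 \<le> deg E V v" if "v \<in> V" "v \<notin> A" for v
      using False pos[OF that(1)] that by (metis One_nat_def Suc_1 le_antisym not_less_eq_eq)
    then have lt: "cnt V (- A) < cnt V A" using s.min_deg_two[OF t] by simp
    have "\<exists>u\<in>V. u \<in> A \<and> deg E V u = 1"
    proof (rule ccontr)
      assume "\<not> ?thesis"
      then have "2 \<le> deg E V v" if "v \<in> V" "v \<in> A" for v
        using pos[OF that(1)] that by (metis One_nat_def Suc_1 le_antisym not_less_eq_eq)
      then show False using min_deg_two[OF t] lt by simp
    qed
    then obtain u where u: "u \<in> V" "u \<in> A" "deg E V u = 1" by blast
    obtain W w where W: "leaf_ext W w u" "V = insert u W" using leaf_removal[OF t u(1,3)] by blast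
    have c: "cnt V A = cnt W A + 1" "cnt V (- A) = cnt W (- A)" using cnt_ext[OF W(1)] W(2) u by auto
    have "card W < card V" using leaf_extD(2,4)[OF W(1)] W(2) by simp
    then have "hbound (cnt W A) (cnt W (- A)) < plap E W {}" if "\<not> exceptional W"
      using IH[OF leaf_extD(1)[OF W(1)]] c lt q2 that by simp
    moreover have "\<forall>v\<in>W \<inter> - A. 2 \<le> deg E (insert u W) v" using two W(2) by auto
    ultimately show ?thesis
      using s.plap_ext_bound[OF W(1)] u(2) c lt q2 ne W(2) exceptional_swap
      by (simp add: hbound_commute)
  qed
qed

text \<open>A base case does not arise: by \<open>leaf_in_pair\<close> and
  \<open>min_deg_two\<close> a tree with both classes of size 2 is exceptional. The two branches
  differ only in which class is called \<open>A\<close>.\<close>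

lemma plap_bound:
  assumes "tree_on E V" "2 \<le> cnt V A" "2 \<le> cnt V (- A)" "\<not> exceptional V"
  shows "hbound (cnt V A) (cnt V (- A)) < plap E V {}"
  using assms
proof (induction "card V" arbitrary: V rule: less_induct)
  case less
  show ?case
  proof (cases "cnt V (- A) \<le> cnt V A")
    case True
    then show ?thesis
      by (rule plap_bound_step[OF less.prems(1) _ less.prems(3,4)]) (rule less.hyps)
  next
    case False
    interpret s: bipartite_graph E "- A" by (rule swap)
    have "hbound (cnt V (- A)) (cnt V (- (- A))) < plap E V {}"
    proof (rule s.plap_bound_step[OF less.prems(1)])
      show "hbound (cnt W (- A)) (cnt W (- (- A))) < plap E W {}"
        if "tree_on E W" "card W < card V" "2 \<le> cnt W (- A)" "2 \<le> cnt W (- (- A))" "\<not> s.exceptional W" for W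
        using less.hyps[of W] that by (simp add: exceptional_swap hbound_commute)
    qed (use False less.prems in \<open>simp_all add: exceptional_swap\<close>)
    then show ?thesis by (simp add: hbound_commute)
  qed
qed

end

section \<open>Trees on an initial segment\<close>

context bipartite_graph
begin

text \<open>The two vertices of \<open>A\<close> have a common neighbour \<open>x\<close>, and every
  other vertex outside \<open>A\<close> is a leaf at exactly one of them. Calling \<open>c\<close>
  the one of smaller degree yields \<open>a \<le> b\<close>, the index range of (i).\<close>

lemma shape_broom:
  assumes t: "tree_on E V" and "cnt V A = 2"
  shows "\<exists>a b. a \<le> b \<and> a + b + 3 = card V \<and> shape broom_rel [1, 1, 1, a, b] V E"
proof -
  interpret s: bipartite_graph E "- A" by (rule swap)
  have fin: "finite V" using t by (rule tree_on_finite)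
  have "card (V \<inter> A) = 2" using assms(2) by (simp add: cnt_def)
  then obtain a b where ab: "V \<inter> A = {a, b}" "a \<noteq> b" by (auto simp: card_2_iff)
  have "\<exists>c y. V \<inter> A = {c, y} \<and> c \<noteq> y \<and> deg E V c \<le> deg E V y"
  proof (cases "deg E V a \<le> deg E V b")
    case False
    then show ?thesis using ab by (intro exI[of _ b] exI[of _ a]) auto
  qed (use ab in blast)
  then obtain c y where cy: "V \<inter> A = {c, y}" "c \<noteq> y" "deg E V c \<le> deg E V y" by blast
  then have mem: "c \<in> V" "c \<in> A" "y \<in> V" "y \<in> A" by auto
  obtain x where x: "x \<in> V" "x \<notin> A" "int (deg E V x) = 2" using deg_two_exists[OF assms] by auto
  have "E x c" "E x y" using s.full_adj[OF fin, of x] x assms(2) mem by auto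
  then have adj: "E c x" "E y x" using sym by blast+
  have leaf: "deg E V j = 1" if "j \<in> V" "j \<notin> A" "j \<noteq> x" for j
    using s.deg_full[OF t x(1), of j] x that assms(2) by auto
  have ex: "E c j \<longleftrightarrow> \<not> E y j" if j: "j \<in> V" "j \<notin> A" "j \<noteq> x" for j
  proof
    assume "E c j"
    then show "\<not> E y j" using nbr_unique[OF leaf[OF j], of c y] mem cy sym by blast
  next
    assume ny: "\<not> E y j"
    have "{i \<in> V. E j i} \<noteq> {}" using leaf[OF j] unfolding deg_def by (metis card.empty zero_neq_one)
    then obtain i where i: "i \<in> V" "E j i" by blast
    then have "i \<in> {c, y}" using bip[of j i] j cy(1) by blast
    then show "E c j" using i sym ny by blast
  qed
  let ?C = "{j \<in> V. E c j} - {x}" and ?Y = "{j \<in> V. E y j} - {x}"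
  let ?ms = "[1, 1, 1, deg E V c - 1, deg E V y - 1]"
  have cards: "card ?C = deg E V c - 1" "card ?Y = deg E V y - 1"
    using adj x by (simp_all add: deg_def)
  have sub: "?C \<subseteq> V \<inter> - A" "?Y \<subseteq> V \<inter> - A" using mem bip by auto
  define cls :: "'a \<Rightarrow> nat" where "cls j = (if j = c then 0 else if j = x then 1 else if j = y then 2
    else if E c j then 3 else 4)" for j
  have "{i \<in> V. cls i = k} = (if k = 0 then {c} else if k = 1 then {x} else if k = 2 then {y}
      else if k = 3 then ?C else if k = 4 then ?Y else {})" for k
  proof -
    have nA: "j \<notin> A" if "j \<in> V" "j \<noteq> c" "j \<noteq> y" for j using that cy(1) by blast
    have c4: "cls i = 4 \<longleftrightarrow> i \<in> ?Y" if "i \<in> V" for i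
    proof (cases "i = c \<or> i = y")
      case True
      then have "\<not> E y i" using bip[of y i] mem by auto
      then show ?thesis using True by (auto simp: cls_def)
    next
      case False
      then show ?thesis using nA[OF that] ex[OF that] that by (auto simp: cls_def)
    qed
    have c3: "cls i = 3 \<longleftrightarrow> i \<in> ?C" if "i \<in> V" for i
      using that bip[of c y] mem by (auto simp: cls_def)
    have c0: "cls i = 0 \<longleftrightarrow> i = c" "cls i = 1 \<longleftrightarrow> i = x" "cls i = 2 \<longleftrightarrow> i = y" "cls i \<le> 4" for i
      using mem x(2) cy(2) by (auto simp: cls_def)
    consider "k = 0" | "k = 1" | "k = 2" | "k = 3" | "k = 4" | "4 < k" by linarith
    then show ?thesis
    proof cases
      case 6
      then have "cls i \<noteq> k" for i using c0(4)[of i] by auto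
      then show ?thesis using 6 by auto
    qed (use c0(1,2,3) c3 c4 mem x(1) in auto)
  qed
  then have "card {i \<in> V. cls i = k} = (if k < length ?ms then ?ms ! k else 0)" for k
    using cards by (auto simp: nth_Cons')
  moreover have "E i j \<longleftrightarrow> symrel {(0, 1), (1, 2), (0, 3), (2, 4)} (cls i) (cls j)"
    if ij: "i \<in> V" "j \<in> V" "i \<in> A" "j \<notin> A" for i j
  proof -
    have j: "j \<noteq> c" "j \<noteq> y" using ij mem by auto
    have "i = c \<or> i = y" using ij cy(1) by blast
    then show ?thesis
    proof
      assume "i = c"
      then show ?thesis using j adj mem x by (auto simp: cls_def symrel_def)
    next
      assume "i = y"
      then show ?thesis using j adj mem x cy(2) ex[OF ij(2,4)] by (auto simp: cls_def symrel_def)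
    qed
  qed
  moreover have "\<not> symrel {(0, 1), (1, 2), (0, 3), (2, 4)} (cls i) (cls j)"
    if ij: "i \<in> V" "j \<in> V" "i \<in> A \<longleftrightarrow> j \<in> A" for i j
  proof -
    have "cls k \<in> {0, 2}" if "k \<in> V" "k \<in> A" for k
      using that cy(1,2) x(2) by (auto simp: cls_def)
    moreover have "cls k \<in> {1, 3, 4}" if "k \<in> V" "k \<notin> A" for k
      using that mem by (auto simp: cls_def)
    ultimately have "cls i \<in> {0, 2} \<and> cls j \<in> {0, 2} \<or> cls i \<in> {1, 3, 4} \<and> cls j \<in> {1, 3, 4}"
      using ij by blast
    then show ?thesis by (auto simp: symrel_def)
  qed
  ultimately have "shape broom_rel ?ms V E"
    unfolding broom_rel_def by (intro bipartite_shapeI[of V _ cls]) auto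
  moreover have "deg E V c - 1 \<le> deg E V y - 1" using cy(3) by simp
  moreover have "deg E V c - 1 + (deg E V y - 1) + 3 = card V"
  proof -
    have "int (deg E V c) + int (deg E V y) = cnt V (- A) + 1"
      using sum_deg[OF t] cy assms(2) by simp
    moreover have "card V = card (V \<inter> A) + card (V \<inter> - A)"
      using fin by (subst card_Un_disjoint[symmetric]) (auto intro: arg_cong[of _ _ card])
    moreover have "1 \<le> deg E V c" "1 \<le> deg E V y"
      using deg_pos[OF t, of c] deg_pos[OF t, of y] mem cy(2) by auto
    ultimately show ?thesis using \<open>card (V \<inter> A) = 2\<close> by (simp add: cnt_def)
  qed
  ultimately show ?thesis by blast
qed

section \<open>From connected acyclic graphs to leaf-by-leaf construction\<close>

lemma tree_path:
  "tree_on E V \<Longrightarrow> a \<in> V \<Longrightarrow> b \<in> V \<Longrightarrow>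
    \<exists>vs. vs \<noteq> [] \<and> distinct vs \<and> set vs \<subseteq> V \<and> hd vs = a \<and> last vs = b \<and> successively E vs"
proof (induction arbitrary: a b rule: tree_on.induct)
  case (single r)
  then show ?case by (intro exI[of _ "[r]"]) auto
next
  case (leaf V x u)
  have ux: "E u x" "E x u" using leaf.hyps(4) sym by blast+
  consider "a = u" "b = u" | "a = u" "b \<in> V" | "a \<in> V" "b = u" | "a \<in> V" "b \<in> V"
    using leaf.prems by blast
  then show ?case
  proof cases
    case 1
    then show ?thesis by (intro exI[of _ "[u]"]) auto
  next
    case 2
    then obtain vs where "vs \<noteq> []" "distinct vs" "set vs \<subseteq> V" "hd vs = x" "last vs = b" "successively E vs"
      using leaf.IH[OF leaf.hyps(2), of b] by blast
    then show ?thesis using 2 leaf.hyps(3) ux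
      by (intro exI[of _ "u # vs"]) (auto simp: successively_Cons)
  next
    case 3
    then obtain vs where "vs \<noteq> []" "distinct vs" "set vs \<subseteq> V" "hd vs = a" "last vs = x" "successively E vs"
      using leaf.IH[OF _ leaf.hyps(2), of a] by blast
    then show ?thesis using 3 leaf.hyps(3) ux
      by (intro exI[of _ "vs @ [u]"]) (auto simp: successively_append_iff)
  next
    case 4
    then obtain vs where "vs \<noteq> []" "distinct vs" "set vs \<subseteq> V" "hd vs = a" "last vs = b" "successively E vs"
      using leaf.IH[of a b] by blast
    then show ?thesis by (intro exI[of _ vs]) auto
  qed
qed

end

lemma rtranclp_crossing:
  assumes "E\<^sup>*\<^sup>* a b" "a \<in> S" "b \<notin> S"
  shows "\<exists>x y. x \<in> S \<and> y \<notin> S \<and> E x y"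
  using assms by (induction rule: rtranclp_induct) auto

text \<open>The vertex set is exhausted along edges leaving the current set \<open>S\<close>. A
  second neighbour of the new vertex \<open>u\<close> in \<open>S\<close> would close a path inside
  \<open>S\<close> to a cycle through \<open>u\<close>.\<close>

lemma is_tree_tree_on:
  fixes E :: "nat \<Rightarrow> nat \<Rightarrow> bool"
  assumes tree: "is_tree n E" and "bipartite_graph E A"
  shows "tree_on E {..<n}"
proof -
  interpret bipartite_graph E A by fact
  have n: "1 \<le> n" and sg: "\<And>i j. E i j \<Longrightarrow> i < n \<and> j < n" and con: "\<And>i j. i < n \<Longrightarrow> j < n \<Longrightarrow> E\<^sup>*\<^sup>* i j"
    and acyc: "acyclic_graph n E"
    using tree unfolding is_tree_def simple_graph_def connected_graph_def by blast+
  have "\<exists>S. tree_on E S \<and> S \<subseteq> {..<n} \<and> card S = Suc k" if "Suc k \<le> n" for k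
    using that
  proof (induction k)
    case 0
    then show ?case using n by (intro exI[of _ "{0}"]) (auto intro: tree_on.single)
  next
    case (Suc k)
    then obtain S where S: "tree_on E S" "S \<subseteq> {..<n}" "card S = Suc k" by auto
    have "S \<noteq> {..<n}" using S Suc.prems by auto
    then obtain b where b: "b < n" "b \<notin> S" using S by auto
    obtain a where a: "a \<in> S" using tree_on_nonempty[OF S(1)] by blast
    have "E\<^sup>*\<^sup>* a b" using con a b S by auto
    then obtain x u where xu: "x \<in> S" "u \<notin> S" "E x u" using rtranclp_crossing[of E a b S] a b by blast
    have un: "u < n" using sg xu by blast
    have "v = x" if v: "v \<in> S" "E u v" for v
    proof (rule ccontr)
      assume "v \<noteq> x"
      obtain vs where vs: "vs \<noteq> []" "distinct vs" "set vs \<subseteq> S" "hd vs = x" "last vs = v" "successively E vs"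
        using tree_path[OF S(1) xu(1) v(1)] by blast
      \<comment> \<open>With \<open>u\<close> appended the cycle reaches the length 3 required by
        \<open>acyclic_graph\<close>.\<close>
      have len: "2 \<le> length vs"
      proof (rule ccontr)
        assume "\<not> ?thesis"
        then have "length vs = 1" using vs(1) by (cases "length vs") (auto simp: not_le)
        then show False using vs(4,5) \<open>v \<noteq> x\<close> by (auto simp: length_Suc_conv)
      qed
      have "successively E (vs @ [u])"
        using vs sym[OF v(2)] by (auto simp: successively_append_iff)
      then have "\<forall>k. Suc k < length (vs @ [u]) \<longrightarrow> E ((vs @ [u]) ! k) ((vs @ [u]) ! Suc k)"
        unfolding successively_conv_nth by blast
      moreover have "E (last (vs @ [u])) (hd (vs @ [u]))" using vs sym[OF xu(3)] by simp
      moreover have "3 \<le> length (vs @ [u])" "distinct (vs @ [u])" "set (vs @ [u]) \<subseteq> {..<n}"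
        using len vs xu(2) S(2) un by auto
      ultimately show False using acyc unfolding acyclic_graph_def by blast
    qed
    then have "tree_on E (insert u S)" using tree_on.leaf[OF S(1) xu(1,2) sym[OF xu(3)]] by blast
    moreover have "card (insert u S) = Suc (Suc k)" using S(3) xu(2) tree_on_finite[OF S(1)] by simp
    ultimately show ?case using S(2) un by (intro exI[of _ "insert u S"]) auto
  qed
  from this[of "n - 1"] obtain S where S: "tree_on E S" "S \<subseteq> {..<n}" "card S = n" using n by auto
  then have "S = {..<n}" by (intro card_subset_eq) auto
  then show ?thesis using S by simp
qed

lemma tree_pqE:
  assumes "tree_pq p q E"
  obtains A where "bipartite_graph E A" "tree_on E {..<p + q}"
    "card ({..<p + q} \<inter> A) = p" "card ({..<p + q} \<inter> - A) = q"
proof -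
  obtain A where A: "A \<subseteq> {..<p + q}" "card A = p" "card ({..<p + q} - A) = q"
    "\<And>i j. E i j \<Longrightarrow> i \<in> A \<longleftrightarrow> j \<notin> A"
    using assms unfolding tree_pq_def has_bipartition_def by blast
  have t: "is_tree (p + q) E" using assms unfolding tree_pq_def by blast
  have b: "bipartite_graph E A"
    using t A(4) by unfold_locales (auto simp: is_tree_def simple_graph_def)
  have "{..<p + q} \<inter> A = A" "{..<p + q} \<inter> - A = {..<p + q} - A" using A(1) by auto
  then show thesis using that[OF b is_tree_tree_on[OF t b]] A(2,3) by simp
qed

lemma per_lap_eq: "per_lap n E = per {..<n} (lap E {..<n})"
proof -
  have "laplacian n E = lap E {..<n}"
    by (simp add: laplacian_def lap_def degree_def deg_def fun_eq_iff)
  then show ?thesis by (simp add: per_lap_def permanent_def per_def)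
qed

lemma shape_graph_iso:
  "shape R ms {..<n} E \<Longrightarrow> shape R ms {..<n} F \<Longrightarrow> graph_iso n E F"
  using shape_iso[of R ms "{..<n}" E "{..<n}" F] unfolding graph_iso_def by auto

lemma graph_iso_per_lap:
  assumes "graph_iso n E F"
  shows "per_lap n E = per_lap n F"
proof -
  let ?V = "{..<n}"
  obtain f where f: "bij_betw f ?V ?V" "\<And>i j. i < n \<Longrightarrow> j < n \<Longrightarrow> E i j \<longleftrightarrow> F (f i) (f j)"
    using assms unfolding graph_iso_def by blast
  have inj: "inj_on f ?V" and surj: "f ` ?V = ?V" using f(1) by (auto simp: bij_betw_def)
  have "deg E ?V i = deg F ?V (f i)" if "i < n" for i
  proof -
    have "f ` {j \<in> ?V. E i j} = {j \<in> ?V. F (f i) j}"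
    proof
      show "f ` {j \<in> ?V. E i j} \<subseteq> {j \<in> ?V. F (f i) j}" using f(2)[OF that] surj by auto
      show "{j \<in> ?V. F (f i) j} \<subseteq> f ` {j \<in> ?V. E i j}"
      proof
        fix k assume k: "k \<in> {j \<in> ?V. F (f i) j}"
        then obtain j where "j \<in> ?V" "k = f j" using surj by blast
        then show "k \<in> f ` {j \<in> ?V. E i j}" using f(2)[OF that, of j] k by blast
      qed
    qed
    moreover have "inj_on f {j \<in> ?V. E i j}" using inj by (rule inj_on_subset) auto
    ultimately show ?thesis unfolding deg_def by (metis card_image)
  qed
  then have *: "lap E ?V i j = lap F ?V (f i) (f j)" if "i \<in> ?V" "j \<in> ?V" for i j
    using that f(2)[of i j] inj_on_eq_iff[OF inj that] by (simp add: lap_def)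
  show ?thesis unfolding per_lap_eq by (rule per_reindex[OF f(1)]) (rule *, simp_all)
qed

section \<open>The extremal trees\<close>

lemma shapeI:
  assumes "\<And>i j. i < n \<Longrightarrow> j < n \<Longrightarrow> E i j \<longleftrightarrow> symrel S (cls i) (cls j)"
    and "\<And>k. {i \<in> {..<n}. cls i = k} = (if k < length Cs then Cs ! k else {})"
  shows "shape (symrel S) (map card Cs) {..<n} E"
  unfolding shape_def using assms by (intro exI[of _ cls]) auto

lemma shape_dstar:
  assumes "1 \<le> p" "1 \<le> q"
  shows "shape (symrel {(0, 1), (0, 2), (1, 3)}) [1, 1, p - 1, q - 1] {..<p + q} (dstar p q)"
proof -
  define cls :: "nat \<Rightarrow> nat" where "cls i = (if i \<le> 1 then i else if i \<le> p then 2 else 3)" for i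
  have "shape (symrel {(0, 1), (0, 2), (1, 3)}) (map card [{0}, {1}, {2..p}, {p + 1..<p + q}]) {..<p + q} (dstar p q)"
  proof (rule shapeI[where cls = cls])
    show "dstar p q i j \<longleftrightarrow> symrel {(0, 1), (0, 2), (1, 3)} (cls i) (cls j)" if "i < p + q" "j < p + q" for i j
      using that assms unfolding dstar_def sym_of_def symrel_def cls_def by auto
    show "{i \<in> {..<p + q}. cls i = k} = (if k < length [{0}, {1}, {2..p}, {p + 1..<p + q}]
        then [{0}, {1}, {2..p}, {p + 1..<p + q}] ! k else {})" for k
      using assms by (auto simp: cls_def nth_Cons' split: if_splits)
  qed
  then show ?thesis by simp
qed

lemma shape_dstar':
  assumes "2 \<le> p" "2 \<le> q"
  shows "shape near_double_star_rel [1, 1, p - 2, q - 2, 1, 1] {..<p + q} (dstar' p q)"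
proof -
  define cls :: "nat \<Rightarrow> nat" where "cls i = (if i \<le> 1 then i else if i < p then 2
    else if i + 3 \<le> p + q then 3 else if i + 2 = p + q then 4 else 5)" for i
  let ?Cs = "[{0}, {1}, {2..<p}, {p..<p + q - 2}, {p + q - 2}, {p + q - 1}]"
  have "shape near_double_star_rel (map card ?Cs) {..<p + q} (dstar' p q)"
    unfolding near_double_star_rel_def
  proof (rule shapeI[where cls = cls])
    have c: "cls i = 0 \<longleftrightarrow> i = 0" "cls i = 1 \<longleftrightarrow> i = 1" "cls i = 2 \<longleftrightarrow> 2 \<le> i \<and> i + 1 \<le> p"
      "cls i = 3 \<longleftrightarrow> p \<le> i \<and> i + 3 \<le> p + q" "cls i = 4 \<longleftrightarrow> i + 2 = p + q" "cls i = 5 \<longleftrightarrow> i + 1 = p + q"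
      if "i < p + q" for i
      using that assms unfolding cls_def by presburger+
    have c5: "cls i \<le> 5" for i by (auto simp: cls_def)
    show "dstar' p q i j \<longleftrightarrow> symrel {(0, 1), (0, 2), (1, 3), (1, 4), (4, 5)} (cls i) (cls j)"
      if "i < p + q" "j < p + q" for i j
      by (simp only: dstar'_def sym_of_def symrel_def insert_iff empty_iff prod.inject c[OF that(1)] c[OF that(2)]
          simp_thms)
    show "{i \<in> {..<p + q}. cls i = k} = (if k < length ?Cs then ?Cs ! k else {})" for k
    proof -
      consider "k = 0" | "k = 1" | "k = 2" | "k = 3" | "k = 4" | "k = 5" | "5 < k" by linarith
      then show ?thesis
      proof cases
        case 7
        then have "cls i \<noteq> k" for i using c5[of i] by linarith
        then show ?thesis using 7 by auto
      qed (use assms c in auto)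
    qed
  qed
  moreover have "p + q - 2 - p = q - 2" by simp
  ultimately show ?thesis by simp
qed

text \<open>Class 1 is the hub carrying the path, here vertex 0. So the hubs are numbered in
  reverse, and the two sizes change places compared with \<open>shape_dstar'\<close>.\<close>

lemma shape_dstar'':
  assumes "2 \<le> p" "2 \<le> q"
  shows "shape near_double_star_rel [1, 1, q - 2, p - 2, 1, 1] {..<p + q} (dstar'' p q)"
proof -
  define cls :: "nat \<Rightarrow> nat" where "cls i = (if i \<le> 1 then 1 - i else if i < p then 3
    else if i + 3 \<le> p + q then 2 else if i + 2 = p + q then 4 else 5)" for i
  let ?Cs = "[{1}, {0}, {p..<p + q - 2}, {2..<p}, {p + q - 2}, {p + q - 1}]"
  have "shape near_double_star_rel (map card ?Cs) {..<p + q} (dstar'' p q)"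
    unfolding near_double_star_rel_def
  proof (rule shapeI[where cls = cls])
    have c: "cls i = 1 \<longleftrightarrow> i = 0" "cls i = 0 \<longleftrightarrow> i = 1" "cls i = 3 \<longleftrightarrow> 2 \<le> i \<and> i + 1 \<le> p"
      "cls i = 2 \<longleftrightarrow> p \<le> i \<and> i + 3 \<le> p + q" "cls i = 4 \<longleftrightarrow> i + 2 = p + q" "cls i = 5 \<longleftrightarrow> i + 1 = p + q"
      if "i < p + q" for i
      using that assms unfolding cls_def by presburger+
    have c5: "cls i \<le> 5" for i by (auto simp: cls_def)
    show "dstar'' p q i j \<longleftrightarrow> symrel {(0, 1), (0, 2), (1, 3), (1, 4), (4, 5)} (cls i) (cls j)"
      if "i < p + q" "j < p + q" for i j
      by (simp only: dstar''_def sym_of_def symrel_def insert_iff empty_iff prod.inject c[OF that(1)] c[OF that(2)]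
          simp_thms disj_ac conj_ac)
    show "{i \<in> {..<p + q}. cls i = k} = (if k < length ?Cs then ?Cs ! k else {})" for k
    proof -
      consider "k = 0" | "k = 1" | "k = 2" | "k = 3" | "k = 4" | "k = 5" | "5 < k" by linarith
      then show ?thesis
      proof cases
        case 7
        then have "cls i \<noteq> k" for i using c5[of i] by linarith
        then show ?thesis using 7 by auto
      qed (use assms c in auto)
    qed
  qed
  moreover have "p + q - 2 - p = q - 2" by simp
  ultimately show ?thesis by simp
qed

lemma shape_Tnka:
  assumes "a + b + 3 = n"
  shows "shape broom_rel [1, 1, 1, a, b] {..<n} (Tnka n 3 a)"
proof -
  define cls :: "nat \<Rightarrow> nat" where "cls i = (if i \<le> 2 then i else if i < a + 3 then 3 else 4)" for i
  let ?Cs = "[{0}, {1}, {2}, {3..<a + 3}, {a + 3..<n}]"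
  have "shape broom_rel (map card ?Cs) {..<n} (Tnka n 3 a)"
    unfolding broom_rel_def
  proof (rule shapeI[where cls = cls])
    show "Tnka n 3 a i j \<longleftrightarrow> symrel {(0, 1), (1, 2), (0, 3), (2, 4)} (cls i) (cls j)"
      if "i < n" "j < n" for i j
      using that assms unfolding Tnka_def sym_of_def symrel_def cls_def by auto
    show "{i \<in> {..<n}. cls i = k} = (if k < length ?Cs then ?Cs ! k else {})" for k
      using assms by (auto simp: cls_def nth_Cons' split: if_splits)
  qed
  moreover have "n - (a + 3) = b" using assms by simp
  ultimately show ?thesis by simp
qed

text \<open>Without leaves at vertex 0 of the path, 0 is itself the one pendant vertex at 1, so the
  hubs of the double star are 1 and 2.\<close>

lemma shape_Tnka_0:
  assumes "4 \<le> n"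
  shows "shape (symrel {(0, 1), (0, 2), (1, 3)}) [1, 1, 1, n - 3] {..<n} (Tnka n 3 0)"
proof -
  define cls :: "nat \<Rightarrow> nat" where "cls i = (if i = 0 then 2 else if i \<le> 2 then i - 1 else 3)" for i
  let ?Cs = "[{1}, {2}, {0}, {3..<n}]"
  have "shape (symrel {(0, 1), (0, 2), (1, 3)}) (map card ?Cs) {..<n} (Tnka n 3 0)"
  proof (rule shapeI[where cls = cls])
    show "Tnka n 3 0 i j \<longleftrightarrow> symrel {(0, 1), (0, 2), (1, 3)} (cls i) (cls j)"
      if "i < n" "j < n" for i j
      using that assms unfolding Tnka_def sym_of_def symrel_def cls_def by auto
    show "{i \<in> {..<n}. cls i = k} = (if k < length ?Cs then ?Cs ! k else {})" for k
      using assms by (auto simp: cls_def nth_Cons' split: if_splits)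
  qed
  then show ?thesis by simp
qed

lemma per_lap_dstar':
  assumes "2 \<le> p" "2 \<le> q"
  shows "per_lap (p + q) (dstar' p q) = (2 * int p - 3) * (6 * int q - 5) + 3"
  using per_near_double_star[OF shape_dstar'[OF assms]] assms
  by (simp add: per_lap_eq of_nat_diff algebra_simps)

lemma per_lap_dstar'':
  assumes "2 \<le> p" "2 \<le> q"
  shows "per_lap (p + q) (dstar'' p q) = (2 * int q - 3) * (6 * int p - 5) + 3"
  using per_near_double_star[OF shape_dstar''[OF assms]] assms
  by (simp add: per_lap_eq of_nat_diff algebra_simps)

lemma per_lap_Tnka_mono:
  assumes "i < j" "j \<le> (n - 3) div 2"
  shows "per_lap n (Tnka n 3 i) < per_lap n (Tnka n 3 j)"
proof -
  have val: "per_lap n (Tnka n 3 a) = 2 * (2 * int a + 1) * (2 * int b + 1) + (2 * int a + 1) + (2 * int b + 1)"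
    if "a + b + 3 = n" for a b
    using per_broom[OF shape_Tnka[OF that]] by (simp add: per_lap_eq)
  obtain d where d: "j = i + d" "0 < d" using assms(1) less_imp_add_positive by blast
  have "2 * j \<le> n - 3" using assms(2) by simp
  then obtain e where "n - 3 = 2 * j + e" using le_Suc_ex by blast
  moreover have "0 < n - 3" using assms by simp
  ultimately have e: "i + (j + d + e) + 3 = n" "j + (j + e) + 3 = n" using d by auto
  \<comment> \<open>The leaf counts are \<open>i\<close>, \<open>j + d + e\<close> and
    \<open>j\<close>, \<open>j + e\<close>; their sums agree and their products differ by
    \<open>d * (d + e)\<close>.\<close>
  have "0 < int d * (int d + int e)" using d(2) by (intro mult_pos_pos) auto
  then show ?thesis unfolding val[OF e(1)] val[OF e(2)] by (simp add: d(1) algebra_simps)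
qed

lemma shape_graph_iso_transfer:
  assumes "graph_iso n E F" "shape R ms {..<n} F"
  shows "shape R ms {..<n} E"
proof -
  obtain f where f: "bij_betw f {..<n} {..<n}" "\<And>i j. i < n \<Longrightarrow> j < n \<Longrightarrow> E i j \<longleftrightarrow> F (f i) (f j)"
    using assms(1) unfolding graph_iso_def by blast
  obtain cls where cls: "\<And>i j. i < n \<Longrightarrow> j < n \<Longrightarrow> F i j \<longleftrightarrow> R (cls i) (cls j)"
    "\<And>k. card {i \<in> {..<n}. cls i = k} = (if k < length ms then ms ! k else 0)"
    using assms(2) unfolding shape_def by auto
  have fn: "f i < n" if "i < n" for i using bij_betwE[OF f(1)] that by auto
  have "card {i \<in> {..<n}. cls (f i) = k} = card {i \<in> {..<n}. cls i = k}" for k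
  proof (rule bij_betw_same_card)
    have "f ` {i \<in> {..<n}. cls (f i) = k} = {i \<in> f ` {..<n}. cls i = k}" by auto
    then show "bij_betw f {i \<in> {..<n}. cls (f i) = k} {i \<in> {..<n}. cls i = k}"
      using f(1) inj_on_subset[of f "{..<n}" "{i \<in> {..<n}. cls (f i) = k}"] by (auto simp: bij_betw_def)
  qed
  then show ?thesis
    unfolding shape_def using f(2) cls fn by (intro exI[of _ "\<lambda>i. cls (f i)"]) auto
qed

lemma extremal_tree_or_per_lap_bound:
  assumes "tree_pq p q E" "2 \<le> p" "p \<le> q"
  shows "graph_iso (p + q) E (dstar p q) \<or>
    graph_iso (p + q) E (dstar' p q) \<or>
    graph_iso (p + q) E (dstar'' p q) \<or>
    (2 * int q - 3) * (6 * int p - 5) + 3 < per_lap (p + q) E"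
proof -
  let ?V = "{..<p + q}"
  obtain A where A: "bipartite_graph E A" "tree_on E ?V" "card (?V \<inter> A) = p" "card (?V \<inter> - A) = q"
    using tree_pqE[OF assms(1)] by blast
  interpret bipartite_graph E A by fact
  have cn: "cnt ?V A = int p" "cnt ?V (- A) = int q" using A by (simp_all add: cnt_def)
  show ?thesis
  proof (cases "exceptional ?V")
    case True
    \<comment> \<open>Deficits 1 and 0 for \<open>A\<close> are deficits 0 and 1 for the complement,
      so D'' is recognised by the lemma for D' with the classes exchanged.\<close>
    then consider "hubs E A ?V 0 0" | "hubs E A ?V 0 1" | "hubs E (- A) ?V 0 1"
      unfolding exceptional_def by (auto simp: hubs_swap)
    then show ?thesis
    proof cases
      case 1
      then show ?thesis
        using shape_graph_iso[OF shape_double_star[OF A(2)] , of "dstar p q"] shape_dstar[of p q] A assms by simp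
    next
      case 2
      then show ?thesis
        using shape_graph_iso[OF shape_near_double_star(1)[OF A(2)], of "dstar' p q"] shape_dstar'[of p q] A assms by simp
    next
      case 3
      then show ?thesis
        using shape_graph_iso[OF bipartite_graph.shape_near_double_star(1)[OF swap A(2)], of "dstar'' p q"]
          shape_dstar''[of p q] A assms by simp
    qed
  next
    case False
    then have "hbound (int p) (int q) < plap E ?V {}" using plap_bound[OF A(2)] cn assms by simp
    then show ?thesis using hbound_le[of "int p" "int q"] assms by (simp add: per_lap_eq plap_def)
  qed
qed

lemma per_lap_second:
  assumes E: "tree_pq p q E" and p: "2 \<le> p" "p \<le> q" and ne: "\<not> graph_iso (p + q) E (dstar p q)"
  shows "(2 * int p - 3) * (6 * int q - 5) + 3 \<le> per_lap (p + q) E"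
    and "per_lap (p + q) E = (2 * int p - 3) * (6 * int q - 5) + 3 \<longleftrightarrow> graph_iso (p + q) E (dstar' p q)"
    and "\<not> graph_iso (p + q) E (dstar' p q) \<Longrightarrow>
      (2 * int q - 3) * (6 * int p - 5) + 3 \<le> per_lap (p + q) E"
    and "\<not> graph_iso (p + q) E (dstar' p q) \<Longrightarrow>
      per_lap (p + q) E = (2 * int q - 3) * (6 * int p - 5) + 3 \<longleftrightarrow> graph_iso (p + q) E (dstar'' p q)"
proof -
  let ?n = "p + q"
  define L M where "L = (2 * int p - 3) * (6 * int q - 5) + 3" and "M = (2 * int q - 3) * (6 * int p - 5) + 3"
  have LM: "M = L + 8 * (int q - int p)" by (simp add: L_def M_def algebra_simps)
  have v': "graph_iso ?n E (dstar' p q) \<Longrightarrow> per_lap ?n E = L"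
    using graph_iso_per_lap per_lap_dstar'[of p q] p by (simp add: L_def)
  have v'': "graph_iso ?n E (dstar'' p q) \<Longrightarrow> per_lap ?n E = M"
    using graph_iso_per_lap per_lap_dstar''[of p q] p by (simp add: M_def)
  \<comment> \<open>For \<open>p = q\<close> the shapes of D' and D'' coincide. So a tree isomorphic
    to D'' but not to D' has \<open>p < q\<close>, and its value is strictly above the one at
    D'.\<close>
  have eq: "graph_iso ?n E (dstar' p q)" if "graph_iso ?n E (dstar'' p q)" "p = q"
  proof -
    have "shape near_double_star_rel [1, 1, q - 2, p - 2, 1, 1] {..<?n} E"
      using that(1) shape_dstar''[of p q] p by (intro shape_graph_iso_transfer[OF that(1)]) auto
    then show ?thesis using shape_graph_iso[OF _ shape_dstar'[of p q]] p that(2) by simp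
  qed
  consider "graph_iso ?n E (dstar' p q)"
    | "\<not> graph_iso ?n E (dstar' p q)" "graph_iso ?n E (dstar'' p q)" "p < q"
    | "\<not> graph_iso ?n E (dstar' p q)" "\<not> graph_iso ?n E (dstar'' p q)" "M < per_lap ?n E"
    using extremal_tree_or_per_lap_bound[OF E p] ne eq p(2)[unfolded le_less] unfolding M_def[symmetric] by blast
  then have "L \<le> per_lap ?n E \<and> (per_lap ?n E = L \<longleftrightarrow> graph_iso ?n E (dstar' p q)) \<and>
    (\<not> graph_iso ?n E (dstar' p q) \<longrightarrow> M \<le> per_lap ?n E \<and> (per_lap ?n E = M \<longleftrightarrow> graph_iso ?n E (dstar'' p q)))"
    using v' v'' LM p(2) by cases auto
  then show "L \<le> per_lap ?n E" "per_lap ?n E = L \<longleftrightarrow> graph_iso ?n E (dstar' p q)"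
    "\<not> graph_iso ?n E (dstar' p q) \<Longrightarrow> M \<le> per_lap ?n E"
    "\<not> graph_iso ?n E (dstar' p q) \<Longrightarrow> per_lap ?n E = M \<longleftrightarrow> graph_iso ?n E (dstar'' p q)"
    by blast+
qed

theorem theorem3p3:
  fixes p q n :: nat
  assumes "1 \<le> p" and "p \<le> q" and "n = p + q"
  shows "(p = 2 \<longrightarrow> 4 \<le> n \<longrightarrow>
            (\<forall>E. tree_pq 2 (n - 2) E \<longrightarrow>
                 (\<exists>!i. i \<le> (n - 3) div 2 \<and> graph_iso n E (Tnka n 3 i))) \<and>
            per_lap n (dstar 2 (n - 2)) = per_lap n (Tnka n 3 0) \<and>
            (\<forall>i j. i < j \<and> j \<le> (n - 3) div 2 \<longrightarrow>
                 per_lap n (Tnka n 3 i) < per_lap n (Tnka n 3 j)))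
       \<and> (2 < p \<longrightarrow>
            (\<forall>E. tree_pq p q E \<and> \<not> graph_iso n E (dstar p q) \<longrightarrow>
                 per_lap n E \<ge> (2 * int p - 3) * (6 * int q - 5) + 3 \<and>
                 (per_lap n E = (2 * int p - 3) * (6 * int q - 5) + 3
                    \<longleftrightarrow> graph_iso n E (dstar' p q))) \<and>
            (q > p \<longrightarrow>
              (\<forall>E. tree_pq p q E \<and> \<not> graph_iso n E (dstar p q)
                     \<and> \<not> graph_iso n E (dstar' p q) \<longrightarrow>
                 per_lap n E \<ge> (2 * int q - 3) * (6 * int p - 5) + 3 \<and>
                 (per_lap n E = (2 * int q - 3) * (6 * int p - 5) + 3
                    \<longleftrightarrow> graph_iso n E (dstar'' p q)))))"
proof (intro conjI impI allI)
  fix E assume n: "4 \<le> n" and t: "tree_pq 2 (n - 2) E"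
  have n2: "2 + (n - 2) = n" using n by simp
  obtain A where A: "bipartite_graph E A" "tree_on E {..<n}" "card ({..<n} \<inter> A) = 2"
    using tree_pqE[OF t] n2 by metis
  obtain a b where ab: "a \<le> b" "a + b + 3 = n" "shape broom_rel [1, 1, 1, a, b] {..<n} E"
    using bipartite_graph.shape_broom[OF A(1,2)] A(3) by (auto simp: cnt_def)
  show "\<exists>!i. i \<le> (n - 3) div 2 \<and> graph_iso n E (Tnka n 3 i)"
  proof (rule ex1I[of _ a])
    show "a \<le> (n - 3) div 2 \<and> graph_iso n E (Tnka n 3 a)"
      using ab shape_graph_iso[OF ab(3) shape_Tnka[OF ab(2)]] by auto
    fix i assume i: "i \<le> (n - 3) div 2 \<and> graph_iso n E (Tnka n 3 i)"
    \<comment> \<open>Uniqueness of the index comes from strict monotonicity: different indices in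
      the range give different permanents.\<close>
    have "per_lap n (Tnka n 3 i) = per_lap n (Tnka n 3 a)"
      using i graph_iso_per_lap shape_graph_iso[OF ab(3) shape_Tnka[OF ab(2)]] by metis
    moreover have "a \<le> (n - 3) div 2" using ab by auto
    ultimately show "i = a"
      using i per_lap_Tnka_mono[of i a n] per_lap_Tnka_mono[of a i n] by (cases i a rule: linorder_cases) auto
  qed
next
  assume "4 \<le> n"
  then have "2 + (n - 2) = n" "n - 2 - 1 = n - 3" by auto
  then have "shape (symrel {(0, 1), (0, 2), (1, 3)}) [1, 1, 1, n - 3] {..<n} (dstar 2 (n - 2))"
    using shape_dstar[of 2 "n - 2"] \<open>4 \<le> n\<close> by simp
  from graph_iso_per_lap[OF shape_graph_iso[OF this shape_Tnka_0[OF \<open>4 \<le> n\<close>]]]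
  show "per_lap n (dstar 2 (n - 2)) = per_lap n (Tnka n 3 0)" .
next
  fix i j assume "i < j \<and> j \<le> (n - 3) div 2"
  then show "per_lap n (Tnka n 3 i) < per_lap n (Tnka n 3 j)" by (intro per_lap_Tnka_mono) auto
qed (use assms per_lap_second[of p q] in auto)

end
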